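(* Let $n$ be a natural number and let $Q\in\mathcal Q_n$. Then there exist matrices $R\in\mathcal R_n$ and $P\in M_n(\mathbb C)_+$ such that $$Q=k_G^{\mathbb C}R-P.$$
   Context: $M_n(\mathbb C)_+$ is the cone of positive (semidefinite) complex $n\times n$ matrices. $\mathcal Q_n=\{X\in M_n(\mathbb C): X\ge0,\ \mathrm{diag}(X)=I_n\}$, i.e. positive semidefinite matrices with all diagonal entries equal to $1$. $\mathcal R_n$ is the closed convex hull of the rank one matrices $(\overline{u_i}\,u_j)_{i,j}$, where $u\in\mathbb C^n$ with $|u_j|=1$ for all $j$. $k_G^{\mathbb C}$ is the little Grothendieck constant: the smallest constant $k$ such that $\|X\|_{cbF}\le\sqrt{k}\,\|X\|_F$ for all $m,n$ and all complex $m\times n$ matrices $X$ (known value $4/\pi$). Here $\|X\|_F$ is the norm of $X$ as an operator from $(\mathbb C^n,\|\cdot\|_\infty)$ (max norm) to $(\mathbb C^m,\|\cdot\|_2)$, and $\|X\|_{cbF}$ is the completely bounded norm of this operator (into the column Hilbert space), concretely $\|X\|_{cbF}=\min\{\|B\|_\infty: X=B\Delta_n(\xi),\ \xi_j\ge0,\ \|\xi\|_2=1\}$, where $\|B\|_\infty$ is the operator norm and $\Delta_n(\xi)$ is the diagonal matrix with diagonal $\xi$. *)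

theory Defs
  imports "HOL-Analysis.Analysis" "Jordan_Normal_Form.Matrix"
begin

text \<open>
  Two matrix types occur. The little Grothendieck constant quantifies over all matrix sizes, so
  its definition uses the type \<open>complex mat\<close>, whose dimensions are values. The sets of
  \<open>n \<times> n\<close> matrices for one fixed \<open>n\<close> use \<open>complex^'n^'n\<close>, on which closure and convex hull
  are available; there \<open>$\<close> is the component access, and \<open>$v\<close> is the one for \<open>complex Matrix.vec\<close>.
\<close>

no_notation Matrix.vec_index (infixl \<open>$\<close> 100)
notation Matrix.vec_index (infixl \<open>$v\<close> 100)

subsection \<open>The little Grothendieck constant\<close>

definition norm2_vec :: "complex Matrix.vec \<Rightarrow> real" where
  "norm2_vec x = L2_set (\<lambda>i. cmod (x $v i)) {..<dim_vec x}"

definition op_norm_mat :: "complex mat \<Rightarrow> real" where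
  "op_norm_mat B =
     (SUP x \<in> {x \<in> carrier_vec (dim_col B). norm2_vec x \<le> 1}. norm2_vec (B *\<^sub>v x))"

definition F_norm :: "complex mat \<Rightarrow> real" where
  "F_norm X =
     (SUP x \<in> {x \<in> carrier_vec (dim_col X). \<forall>j < dim_col X. cmod (x $v j) \<le> 1}.
        norm2_vec (X *\<^sub>v x))"

text \<open>
  The completely bounded norm of \<open>X\<close> as a map from \<open>\<complex>\<^sup>n\<close> with the max norm to the column Hilbert
  space, in its factorization form \<open>X = B \<Delta>\<^sub>n(\<xi>)\<close>. The infima here and below are minima.
  For a matrix with no columns there is no unit vector \<open>\<xi>\<close> and the set below is empty, so only
  nonempty matrices are considered in the definition of the constant.
\<close>

definition cbF_norm :: "complex mat \<Rightarrow> real" where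
  "cbF_norm X = Inf {op_norm_mat B | B (\<xi> :: nat \<Rightarrow> real).
     B \<in> carrier_mat (dim_row X) (dim_col X) \<and>
     (\<forall>j < dim_col X. 0 \<le> \<xi> j) \<and> L2_set \<xi> {..<dim_col X} = 1 \<and>
     X = B * mat_diag (dim_col X) (\<lambda>j. complex_of_real (\<xi> j))}"

definition little_Grothendieck_const :: real where
  "little_Grothendieck_const = Inf {k. 0 \<le> k \<and>
     (\<forall>m n X. 0 < m \<longrightarrow> 0 < n \<longrightarrow> X \<in> carrier_mat m n \<longrightarrow>
        cbF_norm X \<le> sqrt k * F_norm X)}"

subsection \<open>Matrices of a fixed size\<close>

definition pos_semidef :: "(complex^'n^'n) set" where
  "pos_semidef = {X. (\<forall>i j. X $ j $ i = cnj (X $ i $ j)) \<and>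
     (\<forall>x :: complex^'n. 0 \<le> Re (\<Sum>i\<in>UNIV. \<Sum>j\<in>UNIV. cnj (x $ i) * X $ i $ j * x $ j))}"

definition Q_mats :: "(complex^'n^'n) set" where
  "Q_mats = {X \<in> pos_semidef. \<forall>i. X $ i $ i = 1}"

definition R_mats :: "(complex^'n^'n) set" where
  "R_mats = closure (convex hull
     {(\<chi> i j. cnj (u $ i) * u $ j) | u :: complex^'n. \<forall>j. cmod (u $ j) = 1})"

end

theory Submission
  imports Defs
begin

text \<open>
  The theorem is the dual form of the inequality \<open>\<parallel>X\<parallel>\<^sub>c\<^sub>b\<^sub>F\<^sup>2 \<le> k \<parallel>X\<parallel>\<^sub>F\<^sup>2\<close>. Let \<open>Q\<close> be positive
  semidefinite with unit diagonal, and let \<open>A = X\<^sup>* X\<close> be any positive semidefinite matrix. If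
  \<open>X = B \<Delta>(\<xi>)\<close>, then \<open>tr (A Q) \<le> \<parallel>B\<parallel>\<^sup>2\<close>, hence \<open>tr (A Q) \<le> \<parallel>X\<parallel>\<^sub>c\<^sub>b\<^sub>F\<^sup>2\<close>
  (\<open>sum_qform_le_cbF_norm\<close>). On the other hand \<open>\<parallel>X\<parallel>\<^sub>F\<^sup>2\<close> is the maximum of
  \<open>u\<^sup>* A u\<close> over the torus (\<open>qform_le_torus\<close>), so that it is at most the maximum of \<open>tr (A R)\<close>
  over \<open>R\<close> in \<open>R_mats\<close>. Therefore no positive semidefinite \<open>A\<close> separates \<open>Q\<close> from the multiples \<open>K R\<close>,
  where \<open>K\<close> is the constant, and \<open>Q = K R - P\<close> follows from the separating hyperplane theorem
  (\<open>pos_semidef_separation\<close>).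

  The constant is defined as an infimum of real numbers, so it must also be shown that the inequality
  holds for some \<open>k\<close> at all. This is proved with \<open>k = 48\<close> (\<open>cbF_norm_le_F_norm\<close>). A maximizer \<open>Q\<close> of
  \<open>tr (A Q)\<close> over the positive semidefinite matrices with unit diagonal yields a diagonal matrix that
  dominates \<open>A\<close> and has trace \<open>tr (A Q)\<close> (\<open>psd_dominated_by_diagonal\<close>), and such a diagonal matrix
  bounds \<open>\<parallel>X\<parallel>\<^sub>c\<^sub>b\<^sub>F\<close>. The trace is bounded by writing \<open>Q\<close> as the covariance of
  sums with random signs and truncating these sums (\<open>psd_dominated_by_small_diagonal\<close>).
\<close>

section \<open>Positive semidefinite matrices over a finite index set\<close>

text \<open>
  The size of the matrices in the definition of the constant is a value, while the theorem is
  about matrices whose size is a type. Both are covered by matrices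
  \<open>A :: 'a \<Rightarrow> 'a \<Rightarrow> complex\<close> of which only the entries over a finite index set \<open>I\<close> matter.
  The value at \<open>x\<close> of the quadratic form of \<open>A\<close> is a real number when \<open>A\<close> is Hermitian.
\<close>

definition qform :: "'a set \<Rightarrow> ('a \<Rightarrow> 'a \<Rightarrow> complex) \<Rightarrow> ('a \<Rightarrow> complex) \<Rightarrow> real" where
  "qform I A x = Re (\<Sum>i\<in>I. \<Sum>j\<in>I. cnj (x i) * A i j * x j)"

definition psd :: "'a set \<Rightarrow> ('a \<Rightarrow> 'a \<Rightarrow> complex) \<Rightarrow> bool" where
  "psd I A \<longleftrightarrow> (\<forall>i\<in>I. \<forall>j\<in>I. A j i = cnj (A i j)) \<and> (\<forall>x. 0 \<le> qform I A x)"

lemma qform_cong: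
  assumes "\<And>i j. i \<in> I \<Longrightarrow> j \<in> I \<Longrightarrow> A i j = B i j" "\<And>i. i \<in> I \<Longrightarrow> x i = y i"
  shows "qform I A x = qform I B y"
  unfolding qform_def using assms by (intro arg_cong[where f=Re] sum.cong) auto

lemma psd_cong:
  assumes "\<And>i j. i \<in> I \<Longrightarrow> j \<in> I \<Longrightarrow> A i j = B i j"
  shows "psd I A \<longleftrightarrow> psd I B"
proof -
  have "qform I A x = qform I B x" for x by (rule qform_cong[OF assms]) auto
  thus ?thesis unfolding psd_def using assms by (metis (no_types, lifting))
qed

lemma psd_hermitian: "psd I A \<Longrightarrow> i \<in> I \<Longrightarrow> j \<in> I \<Longrightarrow> A j i = cnj (A i j)"
  unfolding psd_def by blast

lemma psd_qform_nonneg: "psd I A \<Longrightarrow> 0 \<le> qform I A x"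
  unfolding psd_def by blast

lemma qform_parallelogram:
  "qform I A (\<lambda>i. x i + y i) + qform I A (\<lambda>i. x i - y i) = 2 * qform I A x + 2 * qform I A y"
proof -
  have *: "cnj (x i + y i) * A i j * (x j + y j) + cnj (x i - y i) * A i j * (x j - y j)
     = 2 * (cnj (x i) * A i j * x j) + 2 * (cnj (y i) * A i j * y j)" for i j
    by (simp add: algebra_simps)
  have "(\<Sum>i\<in>I. \<Sum>j\<in>I. cnj (x i + y i) * A i j * (x j + y j))
      + (\<Sum>i\<in>I. \<Sum>j\<in>I. cnj (x i - y i) * A i j * (x j - y j))
      = 2 * (\<Sum>i\<in>I. \<Sum>j\<in>I. cnj (x i) * A i j * x j)
      + 2 * (\<Sum>i\<in>I. \<Sum>j\<in>I. cnj (y i) * A i j * y j)"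
    by (simp only: sum.distrib[symmetric] * sum_distrib_left)
  from arg_cong[where f=Re, OF this] show ?thesis
    by (simp add: qform_def)
qed

lemma qform_scale: "qform I A (\<lambda>i. c * x i) = (cmod c)\<^sup>2 * qform I A x"
proof -
  have "(\<Sum>i\<in>I. \<Sum>j\<in>I. cnj (c * x i) * A i j * (c * x j))
      = complex_of_real ((cmod c)\<^sup>2) * (\<Sum>i\<in>I. \<Sum>j\<in>I. cnj (x i) * A i j * x j)"
    unfolding sum_distrib_left
    by (intro sum.cong refl) (simp add: complex_norm_square mult_ac del: of_real_power)
  from arg_cong[where f=Re, OF this] show ?thesis by (simp add: qform_def)
qed

lemma qform_gram:
  assumes "finite I" "finite K"
  shows "qform I (\<lambda>i j. \<Sum>k\<in>K. cnj (v k i) * v k j) x = (\<Sum>k\<in>K. (cmod (\<Sum>j\<in>I. v k j * x j))\<^sup>2)"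
proof -
  have "complex_of_real ((cmod (\<Sum>j\<in>I. v k j * x j))\<^sup>2)
      = (\<Sum>i\<in>I. \<Sum>j\<in>I. cnj (x i) * (cnj (v k i) * v k j) * x j)" for k
    by (subst complex_norm_square, subst mult.commute, subst cnj_sum, subst sum_product)
      (intro sum.cong refl, simp add: mult_ac)
  hence "(\<Sum>k\<in>K. complex_of_real ((cmod (\<Sum>j\<in>I. v k j * x j))\<^sup>2))
      = (\<Sum>k\<in>K. \<Sum>i\<in>I. \<Sum>j\<in>I. cnj (x i) * (cnj (v k i) * v k j) * x j)" by simp
  also have "\<dots> = (\<Sum>i\<in>I. \<Sum>j\<in>I. \<Sum>k\<in>K. cnj (x i) * (cnj (v k i) * v k j) * x j)"
    by (subst sum.swap) (rule sum.cong[OF refl], subst sum.swap, rule refl)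
  also have "\<dots> = (\<Sum>i\<in>I. \<Sum>j\<in>I. cnj (x i) * (\<Sum>k\<in>K. cnj (v k i) * v k j) * x j)"
    by (simp add: sum_distrib_left sum_distrib_right)
  finally have "complex_of_real (\<Sum>k\<in>K. (cmod (\<Sum>j\<in>I. v k j * x j))\<^sup>2) = \<dots>"
    by (simp only: of_real_sum)
  from arg_cong[where f=Re, OF this] show ?thesis by (simp only: qform_def Re_complex_of_real)
qed

lemma psd_gram:
  assumes "finite I" "finite K"
  shows "psd I (\<lambda>i j. \<Sum>k\<in>K. cnj (v k i) * v k j)"
  unfolding psd_def qform_gram[OF assms]
  by (intro conjI ballI allI sum_nonneg) (simp_all add: mult.commute[of "cnj _"])

lemma qform_insert:
  assumes "finite I" "a \<notin> I" "\<And>j. j \<in> I \<Longrightarrow> A j a = cnj (A a j)"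
  shows "qform (insert a I) A x
    = qform I A x + 2 * Re (cnj (x a) * (\<Sum>j\<in>I. A a j * x j)) + Re (A a a) * (cmod (x a))\<^sup>2"
proof -
  let ?s = "\<Sum>j\<in>I. A a j * x j"
  have c: "(\<Sum>i\<in>I. cnj (x i) * A i a * x a) = cnj (cnj (x a) * ?s)"
    using assms(3) by (simp add: sum_distrib_right sum_distrib_left mult_ac)
  have r: "(\<Sum>j\<in>I. cnj (x a) * A a j * x j) = cnj (x a) * ?s"
    by (simp add: sum_distrib_left mult_ac)
  have d: "Re (cnj (x a) * A a a * x a) = Re (A a a) * (cmod (x a))\<^sup>2"
    unfolding cmod_power2 by (simp add: algebra_simps power2_eq_square)
  have "(\<Sum>i\<in>insert a I. \<Sum>j\<in>insert a I. cnj (x i) * A i j * x j)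
     = cnj (x a) * A a a * x a + (\<Sum>j\<in>I. cnj (x a) * A a j * x j)
       + ((\<Sum>i\<in>I. cnj (x i) * A i a * x a) + (\<Sum>i\<in>I. \<Sum>j\<in>I. cnj (x i) * A i j * x j))"
    using assms(1,2) by (simp add: sum.distrib)
  hence "qform (insert a I) A x = Re (cnj (x a) * A a a * x a) + Re (cnj (x a) * ?s)
       + (Re (cnj (cnj (x a) * ?s)) + qform I A x)"
    by (simp only: qform_def c r plus_complex.sel)
  thus ?thesis unfolding d by (simp only: cnj.sel)
qed

lemma psd_diag_nonneg:
  assumes "finite I" "psd I A" "i \<in> I"
  shows "0 \<le> Re (A i i)" "A i i = complex_of_real (Re (A i i))"
proof -
  have "A i i = cnj (A i i)" using psd_hermitian[OF assms(2,3,3)] .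
  thus "A i i = complex_of_real (Re (A i i))" by (simp add: complex_eq_iff)
  have "0 \<le> qform I A (\<lambda>j. if j = i then 1 else 0)" using assms by (intro psd_qform_nonneg)
  also have "qform I A (\<lambda>j. if j = i then 1 else 0) = qform I (\<lambda>j k. if k = i then if j = i then A i i else 0 else 0) (\<lambda>_. 1)"
    unfolding qform_def by (intro arg_cong[where f=Re] sum.cong refl) auto
  also have "\<dots> = Re (A i i)"
    unfolding qform_def using assms by (simp del: Re_sum)
  finally show "0 \<le> Re (A i i)" .
qed

text \<open>
  Cholesky factorization: the induction removes one index \<open>a\<close> and subtracts from \<open>A\<close> the rank one
  matrix that has the same row and column \<open>a\<close>. What remains is the Schur complement.
\<close>

lemma psd_imp_gram:
  assumes "finite I" "psd I A"
  obtains v :: "'a \<Rightarrow> 'a \<Rightarrow> complex"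
  where "\<And>i j. i \<in> I \<Longrightarrow> j \<in> I \<Longrightarrow> A i j = (\<Sum>k\<in>I. cnj (v k i) * v k j)"
proof -
  have "\<exists>v :: 'a \<Rightarrow> 'a \<Rightarrow> complex. \<forall>i\<in>I. \<forall>j\<in>I. A i j = (\<Sum>k\<in>I. cnj (v k i) * v k j)"
    using assms
  proof (induction I arbitrary: A rule: finite_induct)
    case empty
    then show ?case by simp
  next
    case (insert a I)
    have herm: "A j i = cnj (A i j)" if "i \<in> insert a I" "j \<in> insert a I" for i j
      using psd_hermitian[OF insert.prems that] .
    define \<alpha> where "\<alpha> = Re (A a a)"
    have \<alpha>: "0 \<le> \<alpha>" "A a a = complex_of_real \<alpha>"
      using psd_diag_nonneg[of "insert a I" A a] insert by (auto simp: \<alpha>_def)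
    let ?s = "\<lambda>x. \<Sum>j\<in>I. A a j * x j"
    \<comment> \<open>The form of \<open>A\<close> at the extension of \<open>x\<close> by \<open>- t\<close> times the value of row \<open>a\<close> at \<open>x\<close>. For
      \<open>t = 1 / \<alpha>\<close> this is the Schur complement, and for \<open>\<alpha> = 0\<close> a large \<open>t\<close> shows that row \<open>a\<close> vanishes.\<close>
    have pos: "0 \<le> qform I A x - 2 * t * (cmod (?s x))\<^sup>2 + \<alpha> * (t\<^sup>2 * (cmod (?s x))\<^sup>2)"
      for x and t :: real
    proof -
      have re: "Re (cnj (- (t *\<^sub>R s)) * s) = - t * (cmod s)\<^sup>2" for s
        unfolding cmod_power2 by (simp add: power2_eq_square algebra_simps)
      define y where "y = x(a := - (t *\<^sub>R ?s x))"
      have "0 \<le> qform (insert a I) A y" using psd_qform_nonneg[OF insert.prems] .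
      also have "\<dots> = qform I A y + 2 * Re (cnj (y a) * ?s y) + \<alpha> * (cmod (y a))\<^sup>2"
        unfolding \<alpha>_def by (rule qform_insert[OF insert.hyps herm]) auto
      also have "qform I A y = qform I A x" 
        by (rule qform_cong) (use insert.hyps in \<open>auto simp: y_def\<close>)
      also have "?s y = ?s x"
        by (rule sum.cong) (use insert.hyps in \<open>auto simp: y_def\<close>)
      also have "y a = - (t *\<^sub>R ?s x)" by (simp add: y_def)
      also note re
      finally show ?thesis by (simp add: power_mult_distrib)
    qed
    have zero: "A a j = 0" if "\<alpha> = 0" "j \<in> I" for j
    proof -
      define x where "x = (\<lambda>i. if i = j then 1 else 0 :: complex)"
      have s: "?s x = A a j" using that insert.hyps by (simp add: x_def if_distrib cong: if_cong)
      have "2 * t * (cmod (A a j))\<^sup>2 \<le> qform I A x" for t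
        using pos[of x t] that unfolding s by simp
      from this[of "(qform I A x + 1) / (2 * (cmod (A a j))\<^sup>2)"] show ?thesis
        by (cases "A a j = 0") auto
    qed
    define w where "w = (\<lambda>j. A a j / complex_of_real (sqrt \<alpha>))"
    \<comment> \<open>Division by 0 gives 0, so that \<open>w = 0\<close> when \<open>\<alpha> = 0\<close>.\<close>
    have ww: "cnj (w i) * w j = cnj (A a i) * A a j / complex_of_real \<alpha>" for i j
      using \<alpha>(1) by (simp add: w_def flip: of_real_mult)
    have wa: "cnj (w a) * w j = A a j" if "j \<in> insert a I" for j
      using that zero[of j] \<alpha> unfolding ww by (cases "\<alpha> = 0") auto
    have wa': "cnj (w j) * w a = A j a" if "j \<in> insert a I" for j
    proof -
      have "cnj (w j) * w a = cnj (cnj (w a) * w j)" by simp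
      also have "\<dots> = A j a" using wa[OF that] herm[OF _ that, of a] by simp
      finally show ?thesis .
    qed
    define B where "B = (\<lambda>i j. A i j - cnj (w i) * w j)"
    have "psd I B"
      unfolding psd_def
    proof (intro conjI ballI allI)
      show "B j i = cnj (B i j)" if "i \<in> I" "j \<in> I" for i j
        unfolding B_def by (subst herm[of i j]) (use that in simp_all)
      show "0 \<le> qform I B x" for x
      proof -
        have "qform I B x = qform I A x - qform I (\<lambda>i j. \<Sum>k\<in>{a}. cnj (w i) * w j) x"
          by (simp only: B_def qform_def left_diff_distrib right_diff_distrib sum_subtractf
              minus_complex.sel sum.insert_if finite.emptyI empty_iff if_False sum.empty add_0_right)
        also have "\<dots> = qform I A x - (cmod (\<Sum>j\<in>I. w j * x j))\<^sup>2"
          by (subst qform_gram) (use insert.hyps in auto)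
        also have "(\<Sum>j\<in>I. w j * x j) = ?s x / complex_of_real (sqrt \<alpha>)"
          by (simp add: w_def sum_divide_distrib)
        also have "(cmod (?s x / complex_of_real (sqrt \<alpha>)))\<^sup>2 = (cmod (?s x))\<^sup>2 / \<alpha>"
          using \<alpha>(1) by (simp add: norm_divide power_divide)
        finally have "qform I B x = qform I A x - (cmod (?s x))\<^sup>2 / \<alpha>" .
        thus ?thesis using pos[of x "1 / \<alpha>"] \<alpha>(1)
          by (cases "\<alpha> = 0") (auto simp: power2_eq_square)
      qed
    qed
    from insert.IH[OF this] obtain v
      where v: "\<And>i j. i \<in> I \<Longrightarrow> j \<in> I \<Longrightarrow> B i j = (\<Sum>k\<in>I. cnj (v k i) * v k j)" by blast
    define u where "u = (\<lambda>k j. if k = a then w j else if j = a then 0 else v k j)"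
    have "A i j = (\<Sum>k\<in>insert a I. cnj (u k i) * u k j)" if ij: "i \<in> insert a I" "j \<in> insert a I" for i j
    proof -
      have "(\<Sum>k\<in>I. cnj (u k i) * u k j) = (if i = a \<or> j = a then 0 else B i j)"
      proof -
        have "(\<Sum>k\<in>I. cnj (u k i) * u k j)
            = (\<Sum>k\<in>I. if i = a \<or> j = a then 0 else cnj (v k i) * v k j)"
          by (rule sum.cong) (use insert.hyps in \<open>auto simp: u_def\<close>)
        thus ?thesis using ij v by auto
      qed
      moreover have "cnj (u a i) * u a j = cnj (w i) * w j" by (simp add: u_def)
      ultimately have "(\<Sum>k\<in>insert a I. cnj (u k i) * u k j)
          = cnj (w i) * w j + (if i = a \<or> j = a then 0 else B i j)"
        using insert.hyps by simp
      thus ?thesis using ij wa wa' by (auto simp: B_def)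
    qed
    thus ?case by blast
  qed
  thus thesis using that by blast
qed

section \<open>Domination of a positive semidefinite matrix by a diagonal matrix\<close>

lemma gram_diag: "(\<Sum>k\<in>K. cnj (v k) * v k) = complex_of_real (\<Sum>k\<in>K. (cmod (v k))\<^sup>2)"
  by (simp only: of_real_sum complex_norm_square mult.commute)

lemma norm_entry_le_1:
  assumes "finite I" "psd I Q" "\<And>i. i \<in> I \<Longrightarrow> Q i i = 1" "i \<in> I" "j \<in> I"
  shows "cmod (Q i j) \<le> 1"
proof -
  obtain v where v: "\<And>i j. i \<in> I \<Longrightarrow> j \<in> I \<Longrightarrow> Q i j = (\<Sum>k\<in>I. cnj (v k i) * v k j)"
    by (rule psd_imp_gram[OF assms(1,2)]) blast
  have d: "(\<Sum>k\<in>I. (cmod (v k i))\<^sup>2) = 1" if "i \<in> I" for i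
  proof -
    have "complex_of_real (\<Sum>k\<in>I. (cmod (v k i))\<^sup>2) = Q i i"
      unfolding v[OF that that] by (rule gram_diag[symmetric])
    thus ?thesis using assms(3)[OF that] by (simp only: of_real_eq_1_iff)
  qed
  have "cmod (Q i j) \<le> (\<Sum>k\<in>I. cmod (v k i) * cmod (v k j))"
    unfolding v[OF assms(4,5)] by (rule order_trans[OF norm_sum]) (simp add: norm_mult)
  also have "\<dots> \<le> (\<Sum>k\<in>I. (cmod (v k i))\<^sup>2 / 2 + (cmod (v k j))\<^sup>2 / 2)"
  proof (rule sum_mono)
    fix k
    show "cmod (v k i) * cmod (v k j) \<le> (cmod (v k i))\<^sup>2 / 2 + (cmod (v k j))\<^sup>2 / 2"
      using zero_le_power2[of "cmod (v k i) - cmod (v k j)"] by (simp add: power2_diff)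
  qed
  also have "\<dots> = 1"
    using d assms(4,5) by (simp add: sum.distrib flip: sum_divide_distrib)
  finally show ?thesis .
qed

text \<open>
  Compactness is with respect to the product topology on functions. The entries are bounded by 1, so
  the set is a closed subset of a product of discs.
\<close>

lemma compact_unit_diagonal_psd:
  fixes I :: "'a set"
  assumes "finite I"
  shows "compact {Q :: 'a \<times> 'a \<Rightarrow> complex. psd I (curry Q) \<and> (\<forall>i. i \<in> I \<longrightarrow> Q (i, i) = 1) \<and>
    (\<forall>p. p \<notin> I \<times> I \<longrightarrow> Q p = 0)}" (is "compact ?S")
proof -
  have "compactin (product_topology (\<lambda>_. euclidean) UNIV)
      (PiE UNIV (\<lambda>_ :: 'a \<times> 'a. cball (0 :: complex) 1))"
    by (subst compactin_PiE) auto
  hence "compact (PiE UNIV (\<lambda>_ :: 'a \<times> 'a. cball (0 :: complex) 1))"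
    unfolding euclidean_product_topology by simp
  moreover have "closed ?S"
    unfolding psd_def qform_def Ball_def curry_def
    by (intro closed_Collect_conj closed_Collect_all closed_Collect_imp open_Collect_const
        closed_Collect_eq closed_Collect_le continuous_intros continuous_on_product_coordinates)
  moreover have "?S \<subseteq> PiE UNIV (\<lambda>_. cball 0 1)"
  proof
    fix Q assume Q: "Q \<in> ?S"
    have "cmod (Q (i, j)) \<le> 1" for i j
      using norm_entry_le_1[of I "curry Q" i j] Q assms by (cases "(i, j) \<in> I \<times> I") auto
    thus "Q \<in> PiE UNIV (\<lambda>_. cball 0 1)" by auto
  qed
  ultimately show ?thesis using compact_Int_closed inf_absorb2 by fastforce
qed

text \<open>
  Adding \<open>t x x\<^sup>*\<close> to a positive semidefinite \<open>Q\<close> with unit diagonal, and rescaling rows and columns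
  by \<open>d\<close>, gives again a matrix of this kind.
\<close>

lemma normalized_rank_one_update:
  fixes x :: "'a \<Rightarrow> complex"
  assumes "finite I" "psd I Q" "\<And>i. i \<in> I \<Longrightarrow> Q i i = 1" "0 \<le> t"
  defines "d \<equiv> \<lambda>i. 1 / sqrt (1 + t * (cmod (x i))\<^sup>2)"
  defines "B \<equiv> \<lambda>i j. complex_of_real (d i * d j) * (Q i j + of_real t * (x i * cnj (x j)))"
  shows "psd I B" "\<And>i. i \<in> I \<Longrightarrow> B i i = 1"
proof -
  have "qform I B y = qform I Q (\<lambda>i. of_real (d i) * y i)
      + t * qform I (\<lambda>i j. \<Sum>k\<in>{()}. cnj (cnj (x i)) * cnj (x j)) (\<lambda>i. of_real (d i) * y i)" for y
  proof -
    have "(\<Sum>i\<in>I. \<Sum>j\<in>I. cnj (y i) * B i j * y j)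
      = (\<Sum>i\<in>I. \<Sum>j\<in>I. cnj (of_real (d i) * y i) * Q i j * (of_real (d j) * y j))
      + of_real t * (\<Sum>i\<in>I. \<Sum>j\<in>I. cnj (of_real (d i) * y i)
          * (\<Sum>k\<in>{()}. cnj (cnj (x i)) * cnj (x j)) * (of_real (d j) * y j))"
      unfolding sum_distrib_left sum.distrib[symmetric]
      by (intro sum.cong refl) (simp add: B_def algebra_simps)
    from arg_cong[where f=Re, OF this] show ?thesis
      by (simp only: qform_def plus_complex.sel Re_complex_of_real Im_complex_of_real
          times_complex.sel(1) mult_zero_left diff_zero)
  qed
  moreover have "0 \<le> qform I (\<lambda>i j. \<Sum>k\<in>{()}. cnj (cnj (x i)) * cnj (x j)) y" for y
    by (intro psd_qform_nonneg psd_gram assms(1)) simp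
  moreover have "B j i = cnj (B i j)" if "i \<in> I" "j \<in> I" for i j
    unfolding B_def by (subst psd_hermitian[OF assms(2) that]) (simp add: mult_ac)
  ultimately show "psd I B"
    unfolding psd_def
    by (simp only: psd_qform_nonneg[OF assms(2)] assms(4) add_nonneg_nonneg mult_nonneg_nonneg) blast
  fix i assume "i \<in> I"
  have "0 < 1 + t * (cmod (x i))\<^sup>2" using assms(4) by (simp add: add_pos_nonneg)
  hence "d i * d i * (1 + t * (cmod (x i))\<^sup>2) = 1" by (simp add: d_def)
  moreover have "B i i = complex_of_real (d i * d i * (1 + t * (cmod (x i))\<^sup>2))"
    using assms(3)[OF \<open>i \<in> I\<close>] by (simp add: B_def flip: complex_norm_square)
  ultimately show "B i i = 1" by simp
qed

text \<open>
  Let \<open>Q\<close> maximize \<open>Re (tr (A Q))\<close> over the positive semidefinite matrices with unit diagonal.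
  Then \<open>A\<close> is dominated by the diagonal matrix with entries \<open>l i = Re ((A Q)\<^sub>i\<^sub>i)\<close>, which are the
  Lagrange multipliers of the constraints on the diagonal. For a given \<open>x\<close>, this is the first order
  condition at \<open>t = 0\<close> along the curve of the preceding lemma. The last conclusion says that the
  multipliers sum to the maximum.
\<close>

lemma psd_dominated_by_diagonal:
  fixes I :: "'a set"
  assumes "finite I" "psd I A"
  obtains Q and l :: "'a \<Rightarrow> real"
  where "psd I Q" "\<And>i. i \<in> I \<Longrightarrow> Q i i = 1" "\<And>i. i \<in> I \<Longrightarrow> 0 \<le> l i"
    "\<And>x. qform I A x \<le> (\<Sum>i\<in>I. l i * (cmod (x i))\<^sup>2)"
    "(\<Sum>i\<in>I. l i) = (\<Sum>i\<in>I. \<Sum>j\<in>I. Re (A j i * Q i j))"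
proof -
  define S where "S = {Q :: 'a \<times> 'a \<Rightarrow> complex. psd I (curry Q) \<and> (\<forall>i. i \<in> I \<longrightarrow> Q (i, i) = 1) \<and>
    (\<forall>p. p \<notin> I \<times> I \<longrightarrow> Q p = 0)}"
  \<comment> \<open>Entries off \<open>I \<times> I\<close> are set to 0, so that the matrices considered form a compact set of functions.\<close>
  define L where "L = (\<lambda>Q. \<Sum>i\<in>I. \<Sum>j\<in>I. Re (A j i * Q (i, j)))"
  define restr where "restr = (\<lambda>B (i, j). if i \<in> I \<and> j \<in> I then B i j else 0 :: complex)"
  have restr: "restr B \<in> S" if "psd I B" "\<And>i. i \<in> I \<Longrightarrow> B i i = 1" for B
  proof -
    have "psd I (curry (restr B)) \<longleftrightarrow> psd I B" by (rule psd_cong) (simp add: restr_def)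
    thus ?thesis using that by (auto simp: S_def restr_def)
  qed
  have "psd I (\<lambda>i j. \<Sum>k\<in>I. cnj (if k = i then 1 else 0) * (if k = j then 1 else 0))"
    using assms(1) by (intro psd_gram) auto
  moreover have "(\<Sum>k\<in>I. cnj (if k = i then 1 else 0) * (if k = i then 1 else 0)) = (1 :: complex)"
    if "i \<in> I" for i
  proof -
    have "(\<Sum>k\<in>I. cnj (if k = i then 1 else 0) * (if k = i then 1 else 0))
        = (\<Sum>k\<in>I. if k = i then 1 else 0 :: complex)" by (intro sum.cong) auto
    thus ?thesis using assms(1) that by simp
  qed
  ultimately have "S \<noteq> {}" using restr by blast
  moreover have "compact S" unfolding S_def using assms(1) by (rule compact_unit_diagonal_psd)
  moreover have "continuous_on S L"
    unfolding L_def by (intro continuous_intros continuous_on_subset[OF continuous_on_product_coordinates]) auto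
  ultimately obtain Q where Q: "Q \<in> S" "\<And>R. R \<in> S \<Longrightarrow> L R \<le> L Q"
    using continuous_attains_sup[of S L] by blast
  hence psdQ: "psd I (curry Q)" and diagQ: "\<And>i. i \<in> I \<Longrightarrow> curry Q i i = 1"
    by (auto simp: S_def)
  define a where "a = (\<lambda>i j. Re (A j i * Q (i, j)))"
  have a_sym: "a i j = a j i" if "i \<in> I" "j \<in> I" for i j
    unfolding a_def using psd_hermitian[OF assms(2) that] psd_hermitian[OF psdQ that] by simp
  define l where "l = (\<lambda>i. \<Sum>j\<in>I. a i j)"
  have dom: "qform I A x \<le> (\<Sum>i\<in>I. l i * (cmod (x i))\<^sup>2)" for x
  proof -
    define b where "b = (\<lambda>i j. Re (A j i * (x i * cnj (x j))))"
    define d where "d = (\<lambda>t i. 1 / sqrt (1 + t * (cmod (x i))\<^sup>2))"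
    define \<phi> where "\<phi> = (\<lambda>t. \<Sum>i\<in>I. \<Sum>j\<in>I. d t i * d t j * (a i j + t * b i j))"
    define D where "D = (\<Sum>i\<in>I. \<Sum>j\<in>I. b i j - a i j * ((cmod (x i))\<^sup>2 + (cmod (x j))\<^sup>2) / 2)"
    have "\<phi> t \<le> \<phi> 0" if "0 \<le> t" for t
    proof -
      define B where "B = (\<lambda>i j. complex_of_real (d t i * d t j)
        * (curry Q i j + of_real t * (x i * cnj (x j))))"
      have "restr B \<in> S"
        using normalized_rank_one_update[OF assms(1) psdQ diagQ that, where x = x]
        unfolding B_def d_def by (intro restr) blast+
      moreover have "L (restr B) = \<phi> t"
        unfolding L_def \<phi>_def
      proof (intro sum.cong refl)
        fix i j assume "i \<in> I" "j \<in> I"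
        hence "A j i * restr B (i, j) = complex_of_real (d t i * d t j)
            * (A j i * Q (i, j) + of_real t * (A j i * (x i * cnj (x j))))"
          by (simp add: restr_def B_def algebra_simps)
        thus "Re (A j i * restr B (i, j)) = d t i * d t j * (a i j + t * b i j)"
          by (simp only: a_def b_def times_complex.sel(1) plus_complex.sel Re_complex_of_real
              Im_complex_of_real) simp
      qed
      moreover have "L Q = \<phi> 0" by (simp add: L_def \<phi>_def d_def a_def)
      ultimately show ?thesis using Q(2) by metis
    qed
    moreover have "(\<phi> has_real_derivative D) (at 0)"
      unfolding \<phi>_def D_def d_def
    proof (intro DERIV_sum)
      fix i j
      show "((\<lambda>t. 1 / sqrt (1 + t * (cmod (x i))\<^sup>2) * (1 / sqrt (1 + t * (cmod (x j))\<^sup>2))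
          * (a i j + t * b i j)) has_real_derivative
          b i j - a i j * ((cmod (x i))\<^sup>2 + (cmod (x j))\<^sup>2) / 2) (at 0)"
        by (auto intro!: derivative_eq_intros simp: field_simps)
    qed
    ultimately have "D \<le> 0"
      using DERIV_pos_inc_right[of \<phi> D 0] by (metis add_0 dense not_le order_less_imp_le)
    moreover have "D = qform I A x - (\<Sum>i\<in>I. l i * (cmod (x i))\<^sup>2)"
    proof -
      have "(\<Sum>i\<in>I. \<Sum>j\<in>I. b i j) = qform I A x"
        unfolding qform_def Re_sum b_def by (subst sum.swap) (simp only: mult_ac)
      moreover have "(\<Sum>i\<in>I. \<Sum>j\<in>I. a i j * (cmod (x j))\<^sup>2) = (\<Sum>i\<in>I. \<Sum>j\<in>I. a i j * (cmod (x i))\<^sup>2)"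
        by (subst sum.swap) (use a_sym in \<open>auto intro!: sum.cong\<close>)
      ultimately show ?thesis
        by (simp add: D_def l_def sum_distrib_right sum_subtractf distrib_left add_divide_distrib
            sum.distrib flip: sum_divide_distrib)
    qed
    ultimately show ?thesis by simp
  qed
  moreover have "0 \<le> l i" if "i \<in> I" for i
  proof -
    have "0 \<le> qform I A (\<lambda>j. if j = i then 1 else 0)" using assms(2) by (rule psd_qform_nonneg)
    also have "\<dots> \<le> (\<Sum>j\<in>I. l j * (cmod (if j = i then 1 else 0))\<^sup>2)" by (rule dom)
    also have "\<dots> = (\<Sum>j\<in>I. if j = i then l j else 0)" by (rule sum.cong) auto
    also have "\<dots> = l i" using assms(1) that by simp
    finally show ?thesis .
  qed
  moreover have "(\<Sum>i\<in>I. l i) = (\<Sum>i\<in>I. \<Sum>j\<in>I. Re (A j i * curry Q i j))" by (simp add: l_def a_def)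
  ultimately show thesis using that[of "curry Q" l] psdQ diagQ by blast
qed

section \<open>Sums with random signs\<close>

text \<open>
  The sum of the numbers \<open>c k\<close>, \<open>k \<in> K\<close>, with signs: plus on \<open>S\<close> and minus off \<open>S\<close>. Averaging over
  all subsets \<open>S\<close> of \<open>K\<close> is taking the expectation over independent uniform signs.
\<close>

definition sign_sum :: "'k set \<Rightarrow> ('k \<Rightarrow> complex) \<Rightarrow> 'k set \<Rightarrow> complex" where
  "sign_sum K c S = (\<Sum>k\<in>K. if k \<in> S then c k else - c k)"

lemma sign_sum_insert:
  assumes "finite K" "a \<notin> K" "S \<subseteq> K"
  shows "sign_sum (insert a K) c S = sign_sum K c S - c a"
    "sign_sum (insert a K) c (insert a S) = sign_sum K c S + c a"
proof -
  have "a \<notin> S" using assms by auto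
  thus "sign_sum (insert a K) c S = sign_sum K c S - c a"
    using assms by (simp add: sign_sum_def)
  have "sign_sum K c (insert a S) = sign_sum K c S"
    unfolding sign_sum_def using assms by (intro sum.cong) auto
  thus "sign_sum (insert a K) c (insert a S) = sign_sum K c S + c a"
    using assms by (simp add: sign_sum_def)
qed

lemma sum_Pow_insert:
  assumes "finite K" "a \<notin> K"
  shows "(\<Sum>S\<in>Pow (insert a K). f S) = (\<Sum>S\<in>Pow K. f S + f (insert a S))"
proof -
  have "inj_on (insert a) (Pow K)" using assms by (auto simp: inj_on_def)
  moreover have "Pow K \<inter> insert a ` Pow K = {}" using assms by auto
  ultimately show ?thesis
    using assms by (simp add: Pow_insert sum.union_disjoint sum.reindex sum.distrib)
qed

lemma sign_sum_second_moment:
  assumes "finite K"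
  shows "(\<Sum>S\<in>Pow K. cnj (sign_sum K c S) * sign_sum K d S)
    = 2 ^ card K * (\<Sum>k\<in>K. cnj (c k) * d k)"
  using assms
proof (induction K rule: finite_induct)
  case empty
  then show ?case by (simp add: sign_sum_def)
next
  case (insert a K)
  have "(\<Sum>S\<in>Pow (insert a K). cnj (sign_sum (insert a K) c S) * sign_sum (insert a K) d S)
      = (\<Sum>S\<in>Pow K. 2 * (cnj (sign_sum K c S) * sign_sum K d S) + 2 * (cnj (c a) * d a))"
    unfolding sum_Pow_insert[OF insert.hyps]
    by (rule sum.cong) (use insert.hyps in \<open>auto simp: sign_sum_insert algebra_simps\<close>)
  also have "\<dots> = 2 * (2 ^ card K * (\<Sum>k\<in>K. cnj (c k) * d k)) + 2 ^ card K * (2 * (cnj (c a) * d a))"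
    using insert.hyps by (simp add: sum.distrib card_Pow insert.IH flip: sum_distrib_left)
  also have "\<dots> = 2 ^ card (insert a K) * (\<Sum>k\<in>insert a K. cnj (c k) * d k)"
    using insert.hyps by (simp add: algebra_simps)
  finally show ?case .
qed

lemma cmod_power4_add_le:
  "cmod (z - w) ^ 4 + cmod (z + w) ^ 4
    \<le> 2 * cmod z ^ 4 + 12 * ((cmod z)\<^sup>2 * (cmod w)\<^sup>2) + 2 * cmod w ^ 4"
proof -
  define r where "r = Re (z * cnj w)"
  have p: "(cmod (z + w))\<^sup>2 = (cmod z)\<^sup>2 + (cmod w)\<^sup>2 + 2 * r"
    and m: "(cmod (z - w))\<^sup>2 = (cmod z)\<^sup>2 + (cmod w)\<^sup>2 - 2 * r"
    unfolding cmod_power2 r_def by (simp_all add: power2_eq_square algebra_simps)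
  have "\<bar>r\<bar> \<le> cmod z * cmod w"
    unfolding r_def using abs_Re_le_cmod[of "z * cnj w"] by (simp add: norm_mult)
  hence "r\<^sup>2 \<le> (cmod z)\<^sup>2 * (cmod w)\<^sup>2"
    using power_mono[of "\<bar>r\<bar>" _ 2] by (fastforce simp: power_mult_distrib)
  moreover have pow4: "x ^ 4 = (x\<^sup>2)\<^sup>2" for x :: real by simp
  ultimately show ?thesis unfolding pow4 p m by (simp add: power2_eq_square algebra_simps)
qed

lemma sign_sum_fourth_moment:
  assumes "finite K"
  shows "(\<Sum>S\<in>Pow K. cmod (sign_sum K c S) ^ 4) \<le> 3 * 2 ^ card K * (\<Sum>k\<in>K. (cmod (c k))\<^sup>2)\<^sup>2"
  using assms
proof (induction K rule: finite_induct)
  case empty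
  then show ?case by (simp add: sign_sum_def)
next
  case (insert a K)
  define s where "s = (\<Sum>k\<in>K. (cmod (c k))\<^sup>2)"
  have "complex_of_real (\<Sum>S\<in>Pow K. (cmod (sign_sum K c S))\<^sup>2)
      = complex_of_real (2 ^ card K * s)"
    using sign_sum_second_moment[OF insert.hyps(1), of c c]
    unfolding gram_diag s_def by (simp only: of_real_mult of_real_power of_real_numeral)
  hence second: "(\<Sum>S\<in>Pow K. (cmod (sign_sum K c S))\<^sup>2) = 2 ^ card K * s"
    by (simp only: of_real_eq_iff)
  have "(\<Sum>S\<in>Pow (insert a K). cmod (sign_sum (insert a K) c S) ^ 4)
      \<le> (\<Sum>S\<in>Pow K. 2 * cmod (sign_sum K c S) ^ 4
          + 12 * ((cmod (sign_sum K c S))\<^sup>2 * (cmod (c a))\<^sup>2) + 2 * cmod (c a) ^ 4)"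
    unfolding sum_Pow_insert[OF insert.hyps]
    by (rule sum_mono) (use insert.hyps cmod_power4_add_le in \<open>auto simp: sign_sum_insert\<close>)
  also have "\<dots> = 2 * (\<Sum>S\<in>Pow K. cmod (sign_sum K c S) ^ 4)
      + 12 * ((2 ^ card K * s) * (cmod (c a))\<^sup>2) + 2 ^ card K * (2 * cmod (c a) ^ 4)"
    using insert.hyps
    by (simp add: sum.distrib card_Pow second flip: sum_distrib_left sum_distrib_right)
  also have "\<dots> \<le> 2 * (3 * 2 ^ card K * s\<^sup>2)
      + 12 * ((2 ^ card K * s) * (cmod (c a))\<^sup>2) + 2 ^ card K * (6 * cmod (c a) ^ 4)"
    using insert.IH unfolding s_def by (intro order_refl add_mono mult_left_mono) auto
  also have "\<dots> = 3 * 2 ^ card (insert a K) * (\<Sum>k\<in>insert a K. (cmod (c k))\<^sup>2)\<^sup>2"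
    using insert.hyps by (simp add: s_def power2_sum algebra_simps flip: power_mult)
  finally show ?case .
qed

text \<open>
  The little Grothendieck inequality, with a constant that is not optimal. The maximizer \<open>Q\<close> of the
  previous section is, up to complex conjugation, the covariance matrix of a vector \<open>w\<close> of random sign
  sums. The part of \<open>w\<close> with entries of modulus at most \<open>\<surd>12\<close> is controlled by \<open>G\<close>. The rest has small
  second moments, by the bound on the fourth moments, and the domination of \<open>A\<close> by the diagonal
  matrix \<open>l\<close> bounds its contribution by half of the total, which is absorbed.
\<close>

lemma psd_dominated_by_small_diagonal:
  fixes I :: "'a set"
  assumes "finite I" "psd I A"
    and G: "\<And>x. (\<And>i. i \<in> I \<Longrightarrow> cmod (x i) \<le> 1) \<Longrightarrow> qform I A x \<le> G"
  obtains l :: "'a \<Rightarrow> real"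
  where "\<And>i. i \<in> I \<Longrightarrow> 0 \<le> l i" "\<And>x. qform I A x \<le> (\<Sum>i\<in>I. l i * (cmod (x i))\<^sup>2)"
    "(\<Sum>i\<in>I. l i) \<le> 48 * G"
proof -
  obtain Q and l :: "'a \<Rightarrow> real" where Q: "psd I Q" "\<And>i. i \<in> I \<Longrightarrow> Q i i = 1"
    and l: "\<And>i. i \<in> I \<Longrightarrow> 0 \<le> l i" "\<And>x. qform I A x \<le> (\<Sum>i\<in>I. l i * (cmod (x i))\<^sup>2)"
      "(\<Sum>i\<in>I. l i) = (\<Sum>i\<in>I. \<Sum>j\<in>I. Re (A j i * Q i j))"
    by (rule psd_dominated_by_diagonal[OF assms(1,2)]) blast
  obtain v where v: "\<And>i j. i \<in> I \<Longrightarrow> j \<in> I \<Longrightarrow> Q i j = (\<Sum>k\<in>I. cnj (v k i) * v k j)"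
    by (rule psd_imp_gram[OF assms(1) Q(1)]) blast
  have v1: "(\<Sum>k\<in>I. (cmod (v k i))\<^sup>2) = 1" if "i \<in> I" for i
  proof -
    have "complex_of_real (\<Sum>k\<in>I. (cmod (v k i))\<^sup>2) = Q i i"
      unfolding v[OF that that] by (rule gram_diag[symmetric])
    thus ?thesis using Q(2)[OF that] by (simp only: of_real_eq_1_iff)
  qed
  define N where "N = (\<Sum>i\<in>I. l i)"
  define M :: real where "M = 2 ^ card I"
  have "0 < M" by (simp add: M_def)
  define w where "w = (\<lambda>S i. sign_sum I (\<lambda>k. cnj (v k i)) S)"
  have cov: "(\<Sum>S\<in>Pow I. cnj (w S j) * w S i) = complex_of_real M * Q i j" if "i \<in> I" "j \<in> I" for i j
    unfolding w_def sign_sum_second_moment[OF assms(1)] v[OF that] by (simp add: M_def mult.commute)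
  have fourth: "(\<Sum>S\<in>Pow I. cmod (w S i) ^ 4) \<le> 3 * M" if "i \<in> I" for i
    using sign_sum_fourth_moment[OF assms(1), of "\<lambda>k. cnj (v k i)"] v1[OF that]
    by (simp add: w_def M_def)
  have "M * N = (\<Sum>S\<in>Pow I. qform I A (w S))"
  proof -
    have "(\<Sum>S\<in>Pow I. \<Sum>i\<in>I. \<Sum>j\<in>I. cnj (w S i) * A i j * w S j)
        = (\<Sum>i\<in>I. \<Sum>j\<in>I. \<Sum>S\<in>Pow I. A i j * (cnj (w S i) * w S j))"
      unfolding mult.commute[of "cnj _" "A _ _"] mult.assoc
      by (subst sum.swap) (rule sum.cong[OF refl], subst sum.swap, rule refl)
    also have "\<dots> = (\<Sum>i\<in>I. \<Sum>j\<in>I. complex_of_real M * (A i j * Q j i))"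
      by (intro sum.cong refl, subst sum_distrib_left[symmetric], subst cov)
        (simp_all add: mult_ac)
    also have "\<dots> = complex_of_real M * (\<Sum>i\<in>I. \<Sum>j\<in>I. A j i * Q i j)"
      by (subst sum.swap) (simp add: sum_distrib_left)
    finally have "(\<Sum>S\<in>Pow I. qform I A (w S)) = Re (complex_of_real M * (\<Sum>i\<in>I. \<Sum>j\<in>I. A j i * Q i j))"
      unfolding qform_def Re_sum[of _ "Pow I", symmetric] by (rule arg_cong)
    also have "\<dots> = M * N"
      unfolding N_def l(3) Re_sum[symmetric] by (simp only: times_complex.sel Re_complex_of_real
          Im_complex_of_real mult_zero_left diff_zero)
    finally show ?thesis by simp
  qed
  also have "\<dots> \<le> (\<Sum>S\<in>Pow I. 24 * G + (\<Sum>i\<in>I. l i * cmod (w S i) ^ 4) / 6)"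
  proof (rule sum_mono)
    fix S
    define y where "y = (\<lambda>i. if (cmod (w S i))\<^sup>2 \<le> 12 then w S i else 0)"
    define r where "r = (\<lambda>i. w S i - y i)"
    have "qform I A (\<lambda>i. y i + r i) \<le> 2 * qform I A y + 2 * qform I A r"
      using qform_parallelogram[of I A y r] psd_qform_nonneg[OF assms(2)] by (metis add.commute le_add_same_cancel2)
    moreover have "(\<lambda>i. y i + r i) = w S" by (simp add: r_def)
    moreover have "qform I A y \<le> 12 * G"
    proof -
      define c where "c = complex_of_real (sqrt 12)"
      have c: "c \<noteq> 0" "cmod c = sqrt 12" by (simp_all add: c_def)
      have "cmod (y i / c) \<le> 1" for i
        unfolding y_def c norm_divide by (simp add: real_le_rsqrt)
      hence "qform I A (\<lambda>i. y i / c) \<le> G" by (intro G)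
      moreover have "qform I A y = (cmod c)\<^sup>2 * qform I A (\<lambda>i. y i / c)"
        using qform_scale[of I A c "\<lambda>i. y i / c"] c(1) by simp
      ultimately show ?thesis by (simp add: c(2))
    qed
    moreover have "qform I A r \<le> (\<Sum>i\<in>I. l i * cmod (w S i) ^ 4) / 12"
    proof -
      have r: "(cmod (r i))\<^sup>2 \<le> cmod (w S i) ^ 4 / 12" for i
      proof (cases "(cmod (w S i))\<^sup>2 \<le> 12")
        case False
        have "12 * (cmod (w S i))\<^sup>2 \<le> (cmod (w S i))\<^sup>2 * (cmod (w S i))\<^sup>2"
          using False by (intro mult_right_mono) auto
        thus ?thesis using False by (simp add: r_def y_def flip: power_add)
      qed (simp add: r_def y_def)
      have "qform I A r \<le> (\<Sum>i\<in>I. l i * (cmod (r i))\<^sup>2)" by (rule l(2))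
      also have "\<dots> \<le> (\<Sum>i\<in>I. l i * (cmod (w S i) ^ 4 / 12))"
        using r l(1) by (intro sum_mono mult_left_mono) auto
      finally show ?thesis by (simp add: sum_divide_distrib)
    qed
    ultimately show "qform I A (w S) \<le> 24 * G + (\<Sum>i\<in>I. l i * cmod (w S i) ^ 4) / 6" by simp
  qed
  also have "\<dots> = M * (24 * G) + (\<Sum>i\<in>I. l i * (\<Sum>S\<in>Pow I. cmod (w S i) ^ 4)) / 6"
  proof -
    have "(\<Sum>S\<in>Pow I. \<Sum>i\<in>I. l i * cmod (w S i) ^ 4) = (\<Sum>i\<in>I. l i * (\<Sum>S\<in>Pow I. cmod (w S i) ^ 4))"
      by (subst sum.swap) (simp add: sum_distrib_left)
    thus ?thesis
      using assms(1) by (simp add: sum.distrib card_Pow M_def flip: sum_divide_distrib)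
  qed
  also have "\<dots> \<le> M * (24 * G) + (\<Sum>i\<in>I. l i * (3 * M)) / 6"
    using fourth l(1) by (intro add_left_mono divide_right_mono sum_mono mult_left_mono) auto
  also have "\<dots> = M * (24 * G + N / 2)"
    by (simp add: N_def algebra_simps flip: sum_distrib_right sum_distrib_left)
  finally have "N \<le> 24 * G + N / 2" using \<open>0 < M\<close> by simp
  hence "(\<Sum>i\<in>I. l i) \<le> 48 * G" by (simp add: N_def)
  thus thesis using that l(1,2) by blast
qed

section \<open>The norms in the definition of the constant\<close>

text \<open>The entries of \<open>X\<^sup>* X\<close>.\<close>

definition gram_entry :: "complex mat \<Rightarrow> nat \<Rightarrow> nat \<Rightarrow> complex" where
  "gram_entry X i j = (\<Sum>k<dim_row X. cnj (X $$ (k, i)) * X $$ (k, j))"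

lemma norm2_vec_nonneg: "0 \<le> norm2_vec x"
  by (simp add: norm2_vec_def L2_set_nonneg)

lemma norm2_vec_power2: "(norm2_vec (Matrix.vec n x))\<^sup>2 = (\<Sum>j<n. (cmod (x j))\<^sup>2)"
  by (simp add: norm2_vec_def L2_set_def sum_nonneg)

lemma psd_gram_entry: "psd {..<n} (gram_entry X)"
  unfolding gram_entry_def by (rule psd_gram) auto

lemma norm2_mult_power2:
  assumes "X \<in> carrier_mat m n"
  shows "(norm2_vec (X *\<^sub>v Matrix.vec n x))\<^sup>2 = qform {..<n} (gram_entry X) x"
proof -
  have "X *\<^sub>v Matrix.vec n x = Matrix.vec m (\<lambda>i. \<Sum>j<n. X $$ (i, j) * x j)"
    using assms by (intro eq_vecI) (auto simp: scalar_prod_def lessThan_atLeast0 intro!: sum.cong)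
  moreover have "gram_entry X = (\<lambda>i j. \<Sum>k<m. cnj (X $$ (k, i)) * X $$ (k, j))"
    using assms by (simp add: gram_entry_def fun_eq_iff)
  ultimately show ?thesis by (simp add: norm2_vec_power2 qform_gram)
qed

lemma norm2_mult_bounded:
  assumes "X \<in> carrier_mat m n"
  obtains C where "\<And>x. (\<And>j. j < n \<Longrightarrow> cmod (x $v j) \<le> 1) \<Longrightarrow> x \<in> carrier_vec n \<Longrightarrow> norm2_vec (X *\<^sub>v x) \<le> C"
proof
  fix x :: "complex Matrix.vec"
  assume x: "\<And>j. j < n \<Longrightarrow> cmod (x $v j) \<le> 1" "x \<in> carrier_vec n"
  have "norm2_vec (X *\<^sub>v x) \<le> (\<Sum>i<m. cmod ((X *\<^sub>v x) $v i))"
    using assms L2_set_le_sum[of "{..<m}" "\<lambda>i. cmod ((X *\<^sub>v x) $v i)"] by (simp add: norm2_vec_def)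
  also have "\<dots> \<le> (\<Sum>i<m. \<Sum>j<n. cmod (X $$ (i, j)))"
  proof (rule sum_mono)
    fix i assume i: "i \<in> {..<m}"
    have "(X *\<^sub>v x) $v i = (\<Sum>j<n. X $$ (i, j) * x $v j)"
      using assms i x(2) by (auto simp: scalar_prod_def lessThan_atLeast0 intro!: sum.cong)
    also have "cmod \<dots> \<le> (\<Sum>j<n. cmod (X $$ (i, j)))"
    proof (rule order_trans[OF norm_sum sum_mono])
      fix j assume "j \<in> {..<n}"
      thus "cmod (X $$ (i, j) * x $v j) \<le> cmod (X $$ (i, j))"
        using x(1)[of j] by (simp add: norm_mult mult_left_le)
    qed
    finally show "cmod ((X *\<^sub>v x) $v i) \<le> (\<Sum>j<n. cmod (X $$ (i, j)))" .
  qed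
  finally show "norm2_vec (X *\<^sub>v x) \<le> (\<Sum>i<m. \<Sum>j<n. cmod (X $$ (i, j)))" .
qed

lemma norm2_mult_le_F_norm:
  assumes "X \<in> carrier_mat m n" "\<And>j. j < n \<Longrightarrow> cmod (x j) \<le> 1"
  shows "norm2_vec (X *\<^sub>v Matrix.vec n x) \<le> F_norm X"
proof -
  obtain C where "\<And>x. (\<And>j. j < n \<Longrightarrow> cmod (x $v j) \<le> 1) \<Longrightarrow> x \<in> carrier_vec n \<Longrightarrow> norm2_vec (X *\<^sub>v x) \<le> C"
    by (rule norm2_mult_bounded[OF assms(1)]) blast
  thus ?thesis
    unfolding F_norm_def using assms by (intro cSUP_upper bdd_aboveI2) auto
qed

lemma F_norm_nonneg:
  assumes "X \<in> carrier_mat m n"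
  shows "0 \<le> F_norm X"
  by (rule order_trans[OF norm2_vec_nonneg norm2_mult_le_F_norm[OF assms, of "\<lambda>_. 0"]]) simp

lemma F_norm_power2_le:
  assumes "X \<in> carrier_mat m n"
    and c: "\<And>x. (\<And>j. j < n \<Longrightarrow> cmod (x j) \<le> 1) \<Longrightarrow> qform {..<n} (gram_entry X) x \<le> c"
  shows "(F_norm X)\<^sup>2 \<le> c"
proof -
  have "0 \<le> c" using c[of "\<lambda>_. 0"] by (simp add: qform_def)
  have "F_norm X \<le> sqrt c"
    unfolding F_norm_def
  proof (rule cSUP_least)
    have "0\<^sub>v (dim_col X) \<in> {x \<in> carrier_vec (dim_col X). \<forall>j<dim_col X. cmod (x $v j) \<le> 1}" by simp
    thus "{x \<in> carrier_vec (dim_col X). \<forall>j<dim_col X. cmod (x $v j) \<le> 1} \<noteq> {}" by blast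
    fix x :: "complex Matrix.vec"
    assume "x \<in> {x \<in> carrier_vec (dim_col X). \<forall>j<dim_col X. cmod (x $v j) \<le> 1}"
    hence x: "\<And>j. j < n \<Longrightarrow> cmod (x $v j) \<le> 1" "Matrix.vec n (\<lambda>j. x $v j) = x"
      using assms(1) by auto
    show "norm2_vec (X *\<^sub>v x) \<le> sqrt c"
      using norm2_mult_power2[OF assms(1), of "\<lambda>j. x $v j"] c[OF x(1)] unfolding x(2)
      by (simp add: real_le_rsqrt)
  qed
  thus ?thesis using \<open>0 \<le> c\<close> F_norm_nonneg[OF assms(1)] by (metis power_mono real_sqrt_pow2)
qed

lemma norm2_mult_le_op_norm:
  assumes "B \<in> carrier_mat m n"
  shows "norm2_vec (B *\<^sub>v Matrix.vec n x) \<le> op_norm_mat B * norm2_vec (Matrix.vec n x)"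
proof -
  let ?S = "{x \<in> carrier_vec (dim_col B). norm2_vec x \<le> 1}"
  have entry: "cmod (y $v j) \<le> 1" if "y \<in> ?S" "j < n" for y j
    using that assms member_le_L2_set[of "{..<n}" j "\<lambda>j. cmod (y $v j)"]
    by (auto simp: norm2_vec_def)
  obtain C where "\<And>x. (\<And>j. j < n \<Longrightarrow> cmod (x $v j) \<le> 1) \<Longrightarrow> x \<in> carrier_vec n \<Longrightarrow> norm2_vec (B *\<^sub>v x) \<le> C"
    by (rule norm2_mult_bounded[OF assms(1)]) blast
  hence "bdd_above ((\<lambda>x. norm2_vec (B *\<^sub>v x)) ` ?S)"
    using entry assms by (intro bdd_aboveI2[of _ _ C]) auto
  hence unit: "norm2_vec (B *\<^sub>v y) \<le> op_norm_mat B" if "y \<in> ?S" for y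
    unfolding op_norm_mat_def using that by (rule cSUP_upper2) auto
  define r where "r = norm2_vec (Matrix.vec n x)"
  have "0 \<le> r" by (simp add: r_def norm2_vec_nonneg)
  have r2: "r\<^sup>2 = (\<Sum>j<n. (cmod (x j))\<^sup>2)" by (simp add: r_def norm2_vec_power2)
  show ?thesis
  proof (cases "r = 0")
    case True
    hence "\<And>j. j < n \<Longrightarrow> x j = 0" using r2 by (simp add: sum_nonneg_eq_0_iff)
    hence "qform {..<n} (gram_entry B) x = qform {..<n} (gram_entry B) (\<lambda>_. 0)"
      by (intro qform_cong) auto
    hence "(norm2_vec (B *\<^sub>v Matrix.vec n x))\<^sup>2 = 0"
      unfolding norm2_mult_power2[OF assms] by (simp add: qform_def)
    thus ?thesis using True by (simp add: r_def)
  next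
    case False
    define z where "z = (\<lambda>j. complex_of_real (1 / r) * x j)"
    have "(norm2_vec (Matrix.vec n z))\<^sup>2 = 1"
      using False by (simp add: norm2_vec_power2 z_def norm_divide power_divide
          flip: sum_divide_distrib r2)
    hence "norm2_vec (Matrix.vec n z) = 1" using norm2_vec_nonneg[of "Matrix.vec n z"]
      by (simp add: power2_eq_1_iff)
    hence "norm2_vec (B *\<^sub>v Matrix.vec n z) \<le> op_norm_mat B"
      using assms by (intro unit) auto
    moreover have "norm2_vec (B *\<^sub>v Matrix.vec n x) = r * norm2_vec (B *\<^sub>v Matrix.vec n z)"
    proof (rule power2_eq_imp_eq)
      show "(norm2_vec (B *\<^sub>v Matrix.vec n x))\<^sup>2 = (r * norm2_vec (B *\<^sub>v Matrix.vec n z))\<^sup>2"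
        unfolding power_mult_distrib norm2_mult_power2[OF assms] z_def qform_scale
        using False by (simp add: norm_divide power_divide)
    qed (use norm2_vec_nonneg \<open>0 \<le> r\<close> in auto)
    ultimately show ?thesis
      using \<open>0 \<le> r\<close> by (simp add: r_def[symmetric] mult.commute[of _ r] mult_left_mono)
  qed
qed

lemma op_norm_mat_nonneg:
  assumes "B \<in> carrier_mat m n" "0 < n"
  shows "0 \<le> op_norm_mat B"
proof -
  have "(norm2_vec (Matrix.vec n (\<lambda>j. if j = 0 then 1 else 0)))\<^sup>2 = (\<Sum>j<n. if j = 0 then 1 else 0)"
    unfolding norm2_vec_power2 by (rule sum.cong) auto
  hence "norm2_vec (Matrix.vec n (\<lambda>j. if j = 0 then 1 else 0)) = 1"
    using assms(2) norm2_vec_nonneg[of "Matrix.vec n (\<lambda>j. if j = 0 then 1 else 0)"]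
    by (simp add: power2_eq_1_iff)
  thus ?thesis
    using norm2_mult_le_op_norm[OF assms(1), of "\<lambda>j. if j = 0 then 1 else 0"]
      norm2_vec_nonneg[of "B *\<^sub>v Matrix.vec n (\<lambda>j. if j = 0 then 1 else 0)"] by simp
qed

lemma op_norm_mat_le:
  assumes "B \<in> carrier_mat m n" "0 \<le> c"
    and c: "\<And>x. qform {..<n} (gram_entry B) x \<le> c\<^sup>2 * (\<Sum>j<n. (cmod (x j))\<^sup>2)"
  shows "op_norm_mat B \<le> c"
  unfolding op_norm_mat_def
proof (rule cSUP_least)
  have "0\<^sub>v (dim_col B) \<in> {x \<in> carrier_vec (dim_col B). norm2_vec x \<le> 1}"
    by (simp add: norm2_vec_def L2_set_def)
  thus "{x \<in> carrier_vec (dim_col B). norm2_vec x \<le> 1} \<noteq> {}" by blast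
  fix x :: "complex Matrix.vec" assume x: "x \<in> {x \<in> carrier_vec (dim_col B). norm2_vec x \<le> 1}"
  hence v: "Matrix.vec n (\<lambda>j. x $v j) = x" using assms(1) by auto
  have "(norm2_vec (B *\<^sub>v x))\<^sup>2 \<le> c\<^sup>2 * (norm2_vec x)\<^sup>2"
    using c[of "\<lambda>j. x $v j"] norm2_mult_power2[OF assms(1), of "\<lambda>j. x $v j"]
      norm2_vec_power2[of n "\<lambda>j. x $v j"] unfolding v by simp
  also have "\<dots> \<le> c\<^sup>2 * 1"
    using x norm2_vec_nonneg[of x] by (intro mult_left_mono) (auto simp: power_le_one)
  finally have "(norm2_vec (B *\<^sub>v x))\<^sup>2 \<le> c\<^sup>2" by simp
  thus "norm2_vec (B *\<^sub>v x) \<le> c" using assms(2) by (rule power2_le_imp_le)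
qed

subsection \<open>The completely bounded norm\<close>

text \<open>The matrices \<open>B\<close> over which the infimum in the definition of \<open>cbF_norm X\<close> is taken.\<close>

definition cb_factors :: "complex mat \<Rightarrow> complex mat set" where
  "cb_factors X = {B. \<exists>\<xi> :: nat \<Rightarrow> real. B \<in> carrier_mat (dim_row X) (dim_col X) \<and>
     (\<forall>j < dim_col X. 0 \<le> \<xi> j) \<and> L2_set \<xi> {..<dim_col X} = 1 \<and>
     X = B * mat_diag (dim_col X) (\<lambda>j. complex_of_real (\<xi> j))}"

lemma cbF_norm_eq: "cbF_norm X = Inf (op_norm_mat ` cb_factors X)"
  unfolding cbF_norm_def cb_factors_def by (rule arg_cong[where f=Inf]) blast

text \<open>For positive \<open>\<xi>\<close>, the factor \<open>B\<close> is found by dividing the columns of \<open>X\<close>.\<close>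

lemma cb_factor:
  assumes X: "X \<in> carrier_mat m n" and "\<And>j. j < n \<Longrightarrow> 0 < \<xi> j" "(\<Sum>j<n. (\<xi> j)\<^sup>2) = 1"
  defines "B \<equiv> Matrix.mat m n (\<lambda>(i, j). X $$ (i, j) / complex_of_real (\<xi> j))"
  shows "B \<in> cb_factors X"
    "qform {..<n} (gram_entry B) x = qform {..<n} (gram_entry X) (\<lambda>j. x j / complex_of_real (\<xi> j))"
proof -
  have B: "B \<in> carrier_mat m n" by (simp add: B_def)
  have nz: "\<xi> j \<noteq> 0" if "j < n" for j using assms(2)[OF that] by simp
  have "X = B * mat_diag n (\<lambda>j. complex_of_real (\<xi> j))"
    unfolding mat_diag_mult_right[OF B] using X nz by (intro eq_matI) (auto simp: B_def)
  moreover have "\<forall>j<n. 0 \<le> \<xi> j" using assms(2) by (simp add: less_imp_le)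
  moreover have "L2_set \<xi> {..<n} = 1" using assms(3) by (simp add: L2_set_def)
  moreover have "dim_row X = m" "dim_col X = n" using X by auto
  ultimately show "B \<in> cb_factors X"
    unfolding cb_factors_def using B by (simp only: mem_Collect_eq) blast
  have g: "gram_entry B i j = gram_entry X i j / complex_of_real (\<xi> i * \<xi> j)" if "i < n" "j < n" for i j
    using X that by (simp add: gram_entry_def B_def sum_divide_distrib)
  have "(\<Sum>i<n. \<Sum>j<n. cnj (x i) * gram_entry B i j * x j)
      = (\<Sum>i<n. \<Sum>j<n. cnj (x i / complex_of_real (\<xi> i)) * gram_entry X i j * (x j / complex_of_real (\<xi> j)))"
    by (intro sum.cong refl) (simp add: g)
  thus "qform {..<n} (gram_entry B) x = qform {..<n} (gram_entry X) (\<lambda>j. x j / complex_of_real (\<xi> j))"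
    unfolding qform_def by (rule arg_cong)
qed

lemma cb_factors_nonempty:
  assumes "X \<in> carrier_mat m n" "0 < n"
  shows "cb_factors X \<noteq> {}"
  using cb_factor(1)[OF assms(1), of "\<lambda>_. 1 / sqrt n"] assms(2) by (auto simp: power_divide)

lemma cb_factors_carrier: "X \<in> carrier_mat m n \<Longrightarrow> B \<in> cb_factors X \<Longrightarrow> B \<in> carrier_mat m n"
  by (auto simp: cb_factors_def)

lemma cbF_norm_nonneg:
  assumes "X \<in> carrier_mat m n" "0 < n"
  shows "0 \<le> cbF_norm X"
  unfolding cbF_norm_eq
  using cb_factors_nonempty[OF assms] op_norm_mat_nonneg[OF cb_factors_carrier[OF assms(1)] assms(2)]
  by (intro cINF_greatest) auto

lemma cbF_norm_le:
  assumes "X \<in> carrier_mat m n" "0 < n" "B \<in> cb_factors X"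
  shows "cbF_norm X \<le> op_norm_mat B"
  unfolding cbF_norm_eq
  using op_norm_mat_nonneg[OF cb_factors_carrier[OF assms(1)] assms(2)]
  by (intro cINF_lower assms(3) bdd_belowI2[of _ 0]) auto

text \<open>
  A diagonal matrix that dominates \<open>X\<^sup>* X\<close> bounds the completely bounded norm: the squares of the
  weights \<open>\<xi>\<close> are the normalized diagonal entries.
\<close>

lemma cbF_norm_power2_le:
  assumes X: "X \<in> carrier_mat m n" and n: "0 < n" and l: "\<And>j. j < n \<Longrightarrow> 0 \<le> l j"
    and dom: "\<And>x. qform {..<n} (gram_entry X) x \<le> (\<Sum>j<n. l j * (cmod (x j))\<^sup>2)"
  shows "(cbF_norm X)\<^sup>2 \<le> (\<Sum>j<n. l j)"
proof (rule field_le_epsilon)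
  fix e :: real assume "0 < e"
  \<comment> \<open>The diagonal is enlarged by \<open>e / n\<close> to make all weights positive.\<close>
  define p where "p = (\<lambda>j. l j + e / n)"
  define s where "s = (\<Sum>j<n. l j) + e"
  have p: "0 < p j" "l j \<le> p j" if "j < n" for j
    using l[OF that] \<open>0 < e\<close> n by (auto simp: p_def add_nonneg_pos)
  have "0 \<le> (\<Sum>j<n. l j)" using l by (intro sum_nonneg) auto
  hence s: "0 < s" "(\<Sum>j<n. p j) = s"
    using \<open>0 < e\<close> n by (auto simp: s_def p_def sum.distrib)
  define \<xi> where "\<xi> = (\<lambda>j. sqrt (p j / s))"
  have \<xi>: "0 < \<xi> j" "(\<xi> j)\<^sup>2 = p j / s" if "j < n" for j
    using p[OF that] s(1) by (simp_all add: \<xi>_def)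
  have "(\<Sum>j<n. (\<xi> j)\<^sup>2) = 1" using s \<xi>(2) by (simp flip: sum_divide_distrib)
  note fac = cb_factor[OF X \<xi>(1) this]
  let ?B = "Matrix.mat m n (\<lambda>(i, j). X $$ (i, j) / complex_of_real (\<xi> j))"
  have "op_norm_mat ?B \<le> sqrt s"
  proof (rule op_norm_mat_le)
    show "qform {..<n} (gram_entry ?B) x \<le> (sqrt s)\<^sup>2 * (\<Sum>j<n. (cmod (x j))\<^sup>2)" for x
    proof -
      have "qform {..<n} (gram_entry ?B) x \<le> (\<Sum>j<n. l j * (cmod (x j / complex_of_real (\<xi> j)))\<^sup>2)"
        using dom fac(2) by metis
      also have "\<dots> \<le> (\<Sum>j<n. s * (cmod (x j))\<^sup>2)"
      proof (rule sum_mono)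
        fix j assume "j \<in> {..<n}"
        hence j: "j < n" by simp
        have "l j * (cmod (x j / complex_of_real (\<xi> j)))\<^sup>2 = l j / p j * (s * (cmod (x j))\<^sup>2)"
          using \<xi>(2)[OF j] by (simp add: norm_divide power_divide)
        also have "\<dots> \<le> 1 * (s * (cmod (x j))\<^sup>2)"
          using p[OF j] s(1) by (intro mult_right_mono) auto
        finally show "l j * (cmod (x j / complex_of_real (\<xi> j)))\<^sup>2 \<le> s * (cmod (x j))\<^sup>2" by simp
      qed
      finally show ?thesis using s(1) by (simp add: sum_distrib_left)
    qed
  qed (use s in auto)
  hence "cbF_norm X \<le> sqrt s" using cbF_norm_le[OF X n fac(1)] by simp
  hence "(cbF_norm X)\<^sup>2 \<le> (sqrt s)\<^sup>2" using cbF_norm_nonneg[OF X n] by (rule power_mono)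
  thus "(cbF_norm X)\<^sup>2 \<le> (\<Sum>j<n. l j) + e" using s(1) by (simp add: s_def)
qed

text \<open>
  The left side is \<open>tr (X\<^sup>* X Q)\<close> for the matrix \<open>Q\<close> with unit diagonal that is the sum of the
  matrices \<open>w k (w k)\<^sup>*\<close>. If \<open>X = B \<Delta>(\<xi>)\<close>, it is at most \<open>\<parallel>B\<parallel>\<^sup>2\<close> times \<open>tr (\<Delta>(\<xi>) Q \<Delta>(\<xi>)) = \<Sum> \<xi>\<^sub>j\<^sup>2 = 1\<close>.
\<close>

lemma sum_qform_le_cbF_norm:
  assumes X: "X \<in> carrier_mat m n" and n: "0 < n"
    and w: "\<And>j. j < n \<Longrightarrow> (\<Sum>k\<in>K. (cmod (w k j))\<^sup>2) = 1"
  shows "(\<Sum>k\<in>K. qform {..<n} (gram_entry X) (w k)) \<le> (cbF_norm X)\<^sup>2"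
proof -
  let ?s = "\<Sum>k\<in>K. qform {..<n} (gram_entry X) (w k)"
  have "sqrt ?s \<le> op_norm_mat B" if "B \<in> cb_factors X" for B
  proof -
    note B = cb_factors_carrier[OF X that]
    note op = op_norm_mat_nonneg[OF B n]
    obtain \<xi> where \<xi>: "L2_set \<xi> {..<n} = 1" "X = B * mat_diag n (\<lambda>j. complex_of_real (\<xi> j))"
    proof -
      have "dim_row X = m" "dim_col X = n" using X by auto
      thus thesis using that \<open>B \<in> cb_factors X\<close> unfolding cb_factors_def by auto
    qed
    have \<xi>2: "(\<Sum>j<n. (\<xi> j)\<^sup>2) = 1" using \<xi>(1) by (simp add: L2_set_def)
    have "qform {..<n} (gram_entry X) (w k) \<le> (op_norm_mat B)\<^sup>2 * (\<Sum>j<n. (\<xi> j)\<^sup>2 * (cmod (w k j))\<^sup>2)" for k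
    proof -
      have "X *\<^sub>v Matrix.vec n (w k) = B *\<^sub>v Matrix.vec n (\<lambda>j. complex_of_real (\<xi> j) * w k j)"
        using B X unfolding \<xi>(2) mat_diag_mult_right[OF B]
        by (intro eq_vecI) (auto simp: scalar_prod_def intro!: sum.cong)
      hence "qform {..<n} (gram_entry X) (w k)
          = (norm2_vec (B *\<^sub>v Matrix.vec n (\<lambda>j. complex_of_real (\<xi> j) * w k j)))\<^sup>2"
        using norm2_mult_power2[OF X, of "w k"] by simp
      also have "\<dots> \<le> (op_norm_mat B * norm2_vec (Matrix.vec n (\<lambda>j. complex_of_real (\<xi> j) * w k j)))\<^sup>2"
        by (intro power_mono norm2_mult_le_op_norm[OF B] norm2_vec_nonneg)
      finally show ?thesis
        by (simp add: power_mult_distrib norm2_vec_power2 norm_mult)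
    qed
    hence "?s \<le> (\<Sum>k\<in>K. (op_norm_mat B)\<^sup>2 * (\<Sum>j<n. (\<xi> j)\<^sup>2 * (cmod (w k j))\<^sup>2))"
      by (rule sum_mono)
    also have "\<dots> = (op_norm_mat B)\<^sup>2 * (\<Sum>j<n. (\<xi> j)\<^sup>2 * (\<Sum>k\<in>K. (cmod (w k j))\<^sup>2))"
      by (simp add: sum_distrib_left sum.swap[of _ K])
    also have "\<dots> = (op_norm_mat B)\<^sup>2" using w \<xi>2 by simp
    finally show ?thesis using op by (rule real_le_lsqrt[rotated -1]) 
  qed
  hence "sqrt ?s \<le> cbF_norm X"
    unfolding cbF_norm_eq using cb_factors_nonempty[OF X n] by (intro cINF_greatest)
  moreover have "0 \<le> ?s" by (intro sum_nonneg psd_qform_nonneg psd_gram_entry)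
  ultimately show ?thesis by (metis power_mono real_sqrt_ge_zero real_sqrt_pow2)
qed

lemma cbF_norm_le_F_norm:
  assumes X: "X \<in> carrier_mat m n" and n: "0 < n"
  shows "cbF_norm X \<le> sqrt 48 * F_norm X"
proof -
  have "qform {..<n} (gram_entry X) x \<le> (F_norm X)\<^sup>2" if "\<And>j. j \<in> {..<n} \<Longrightarrow> cmod (x j) \<le> 1" for x
    using power_mono[OF norm2_mult_le_F_norm[OF X, of x] norm2_vec_nonneg, of 2] that
    by (simp add: norm2_mult_power2[OF X])
  then obtain l where "\<And>j. j \<in> {..<n} \<Longrightarrow> 0 \<le> l j"
      "\<And>x. qform {..<n} (gram_entry X) x \<le> (\<Sum>j<n. l j * (cmod (x j))\<^sup>2)"
      "(\<Sum>j<n. l j) \<le> 48 * (F_norm X)\<^sup>2"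
    using psd_dominated_by_small_diagonal[OF finite_lessThan psd_gram_entry, of n X "(F_norm X)\<^sup>2"] by blast
  hence "(cbF_norm X)\<^sup>2 \<le> (sqrt 48 * F_norm X)\<^sup>2"
    using cbF_norm_power2_le[OF X n, of l] by (simp add: power_mult_distrib)
  thus ?thesis by (rule power2_le_imp_le) (simp add: F_norm_nonneg[OF X])
qed

text \<open>
  The numbers over which the infimum in the definition of the constant is taken. Since there is such a
  number, an inequality that is valid for all of them passes to the infimum.
\<close>

definition Grothendieck_bounds :: "real set" where
  "Grothendieck_bounds = {k. 0 \<le> k \<and> (\<forall>m n X. 0 < m \<longrightarrow> 0 < n \<longrightarrow> X \<in> carrier_mat m n \<longrightarrow>
        cbF_norm X \<le> sqrt k * F_norm X)}"

lemma Grothendieck_bounds_nonempty: "Grothendieck_bounds \<noteq> {}"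
proof -
  have "48 \<in> Grothendieck_bounds"
    unfolding Grothendieck_bounds_def using cbF_norm_le_F_norm by auto
  thus ?thesis by blast
qed

lemma little_Grothendieck_const_eq: "little_Grothendieck_const = Inf Grothendieck_bounds"
  by (simp add: little_Grothendieck_const_def Grothendieck_bounds_def)

lemma little_Grothendieck_const_nonneg: "0 \<le> little_Grothendieck_const"
  unfolding little_Grothendieck_const_eq
  by (rule cInf_greatest[OF Grothendieck_bounds_nonempty]) (simp add: Grothendieck_bounds_def)

lemma le_little_Grothendieck_const_mult:
  assumes "0 \<le> g" and k: "\<And>k. k \<in> Grothendieck_bounds \<Longrightarrow> a \<le> k * g"
  shows "a \<le> little_Grothendieck_const * g"
proof (cases "g = 0")
  case True
  thus ?thesis using k Grothendieck_bounds_nonempty by auto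
next
  case False
  have "a / g \<le> little_Grothendieck_const"
    unfolding little_Grothendieck_const_eq using False assms(1) k
    by (intro cInf_greatest Grothendieck_bounds_nonempty) (auto simp: divide_le_eq)
  thus ?thesis using False assms(1) by (simp add: divide_le_eq)
qed

section \<open>From the polydisc to the torus\<close>

lemma disc_midpoint_of_circle:
  assumes "cmod z \<le> 1"
  obtains d where "cmod (z + d) = 1" "cmod (z - d) = 1"
proof -
  define r where "r = cmod z"
  obtain w where w: "cmod w = 1" "z = complex_of_real r * w"
  proof (cases "z = 0")
    case True
    thus ?thesis using that[of 1] by (simp add: r_def)
  next
    case False
    thus ?thesis using that[of "z / complex_of_real r"] by (simp add: r_def norm_divide)
  qed
  have r: "0 \<le> r" "r\<^sup>2 \<le> 1" using assms by (auto simp: r_def power_le_one)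
  define s where "s = sqrt (1 - r\<^sup>2)"
  have s: "r\<^sup>2 + s\<^sup>2 = 1" using r by (simp add: s_def)
  have "cmod (Complex r s) = 1" "cmod (Complex r (- s)) = 1" using s by (simp_all add: cmod_def)
  moreover have "z + \<i> * complex_of_real s * w = Complex r s * w"
    "z - \<i> * complex_of_real s * w = Complex r (- s) * w"
    unfolding w(2) by (simp_all add: Complex_eq algebra_simps)
  ultimately show thesis using that[of "\<i> * complex_of_real s * w"] w(1) by (simp add: norm_mult)
qed

text \<open>
  A positive semidefinite form is convex. So, one coordinate after the other, a point of the disc can be
  replaced by one of the two points of the circle whose midpoint it is, without decreasing the form.
\<close>

lemma qform_le_torus:
  assumes "finite I" "psd I A" "\<And>i. i \<in> I \<Longrightarrow> cmod (x i) \<le> 1"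
  obtains u where "\<And>i. i \<in> I \<Longrightarrow> cmod (u i) = 1" "qform I A x \<le> qform I A u"
proof -
  have "\<exists>u. (\<forall>i\<in>F. cmod (u i) = 1) \<and> (\<forall>i. i \<notin> F \<longrightarrow> u i = x i) \<and> qform I A x \<le> qform I A u"
    if "finite F" "F \<subseteq> I" for F
    using that
  proof (induction F rule: finite_induct)
    case empty
    show ?case by (intro exI[of _ x]) auto
  next
    case (insert a F)
    then obtain u where u: "\<And>i. i \<in> F \<Longrightarrow> cmod (u i) = 1" "\<And>i. i \<notin> F \<Longrightarrow> u i = x i"
      "qform I A x \<le> qform I A u" by auto
    have "cmod (u a) \<le> 1" using u(2)[OF insert.hyps(2)] assms(3)[of a] insert.prems by simp
    then obtain d where d: "cmod (u a + d) = 1" "cmod (u a - d) = 1" by (rule disc_midpoint_of_circle)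
    define e where "e = (\<lambda>i. if i = a then d else 0)"
    have larger: "qform I A u \<le> qform I A (\<lambda>i. u i + e i) \<or> qform I A u \<le> qform I A (\<lambda>i. u i - e i)"
      using qform_parallelogram[of I A u e] psd_qform_nonneg[OF assms(2), of e] by linarith
    have plus: "cmod (u i + e i) = 1" if "i \<in> insert a F" for i
      using that d u(1) by (auto simp: e_def)
    have minus: "cmod (u i - e i) = 1" if "i \<in> insert a F" for i
      using that d u(1) by (auto simp: e_def)
    have off: "u i + e i = x i" "u i - e i = x i" if "i \<notin> insert a F" for i
      using that u(2) by (auto simp: e_def)
    show ?case
      using larger
    proof (elim disjE)
      assume "qform I A u \<le> qform I A (\<lambda>i. u i + e i)"
      thus ?thesis using u(3) plus off(1) by (intro exI[of _ "\<lambda>i. u i + e i"]) auto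
    next
      assume "qform I A u \<le> qform I A (\<lambda>i. u i - e i)"
      thus ?thesis using u(3) minus off(2) by (intro exI[of _ "\<lambda>i. u i - e i"]) auto
    qed
  qed
  from this[OF assms(1) order_refl] show thesis using that by blast
qed

section \<open>Positive semidefinite matrices of a fixed size\<close>

lemma pos_semidef_iff:
  fixes X :: "complex^'n^'n"
  shows "X \<in> pos_semidef \<longleftrightarrow> psd UNIV (\<lambda>i j. X $ i $ j)"
proof -
  have "(\<forall>x :: complex^'n. 0 \<le> Re (\<Sum>i\<in>UNIV. \<Sum>j\<in>UNIV. cnj (x $ i) * X $ i $ j * x $ j))
      \<longleftrightarrow> (\<forall>x. 0 \<le> qform UNIV (\<lambda>i j. X $ i $ j) x)" (is "?l \<longleftrightarrow> ?r")
  proof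
    assume l: ?l
    show ?r
    proof
      fix x :: "'n \<Rightarrow> complex"
      show "0 \<le> qform UNIV (\<lambda>i j. X $ i $ j) x"
        using l[rule_format, of "\<chi> i. x i"] by (simp only: qform_def vec_lambda_beta)
    qed
  next
    assume ?r
    thus ?l unfolding qform_def by blast
  qed
  thus ?thesis unfolding pos_semidef_def psd_def by (simp only: mem_Collect_eq) blast
qed

lemma closed_pos_semidef: "closed pos_semidef"
  unfolding pos_semidef_def
  by (intro closed_Collect_conj closed_Collect_all closed_Collect_eq closed_Collect_le
      continuous_on_Re continuous_on_sum continuous_on_mult continuous_on_cnj continuous_on_component
      continuous_on_const continuous_on_id)

lemma qform_lincomb:
  "qform I (\<lambda>i j. s *\<^sub>R A i j + t *\<^sub>R B i j) x = s * qform I A x + t * qform I B x"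
proof -
  have "(\<Sum>i\<in>I. \<Sum>j\<in>I. cnj (x i) * (s *\<^sub>R A i j + t *\<^sub>R B i j) * x j)
     = s *\<^sub>R (\<Sum>i\<in>I. \<Sum>j\<in>I. cnj (x i) * A i j * x j) + t *\<^sub>R (\<Sum>i\<in>I. \<Sum>j\<in>I. cnj (x i) * B i j * x j)"
    unfolding scaleR_sum_right sum.distrib[symmetric]
    by (intro sum.cong refl) (simp add: distrib_left distrib_right)
  from arg_cong[where f=Re, OF this] show ?thesis
    by (simp only: qform_def plus_complex.sel scaleR_complex.sel)
qed

lemma pos_semidef_lincomb:
  assumes "A \<in> pos_semidef" "B \<in> pos_semidef" "0 \<le> s" "0 \<le> t"
  shows "s *\<^sub>R A + t *\<^sub>R B \<in> pos_semidef"
proof -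
  have herm: "A $ j $ i = cnj (A $ i $ j)" "B $ j $ i = cnj (B $ i $ j)" for i j
    using assms(1,2) unfolding pos_semidef_def by blast+
  have "(s *\<^sub>R A + t *\<^sub>R B) $ j $ i = cnj ((s *\<^sub>R A + t *\<^sub>R B) $ i $ j)" for i j
    unfolding vector_add_component vector_scaleR_component
    by (subst herm(1)[where i = i and j = j], subst herm(2)[where i = i and j = j]) simp
  moreover have "0 \<le> qform UNIV (\<lambda>i j. (s *\<^sub>R A + t *\<^sub>R B) $ i $ j) x" for x
    using assms by (simp add: qform_lincomb pos_semidef_iff psd_qform_nonneg)
  ultimately show ?thesis unfolding pos_semidef_iff psd_def by blast
qed

lemma convex_pos_semidef: "convex pos_semidef"
  by (rule convexI) (rule pos_semidef_lincomb)

text \<open>The matrix with entries \<open>cnj (u i) u j\<close>. For \<open>u\<close> on the torus, these generate \<open>R_mats\<close>.\<close>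

definition rank_one :: "complex^'n \<Rightarrow> complex^'n^'n" where
  "rank_one u = (\<chi> i j. cnj (u $ i) * u $ j)"

lemma rank_one_pos_semidef: "rank_one u \<in> pos_semidef"
proof -
  have "psd UNIV (\<lambda>i j. cnj (u $ i) * u $ j)"
    using psd_gram[of UNIV "{()}" "\<lambda>_ i. u $ i"] by simp
  moreover have "psd UNIV (\<lambda>i j. rank_one u $ i $ j) \<longleftrightarrow> psd UNIV (\<lambda>i j. cnj (u $ i) * u $ j)"
    by (rule psd_cong) (simp add: rank_one_def)
  ultimately show ?thesis unfolding pos_semidef_iff by blast
qed

lemma inner_rank_one: "inner A (rank_one u) = qform UNIV (\<lambda>i j. A $ i $ j) (\<lambda>i. cnj (u $ i))"
proof -
  have "inner z w = Re (z * cnj w)" for z w :: complex by (simp add: inner_complex_def)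
  thus ?thesis
    unfolding inner_vec_def qform_def Re_sum rank_one_def
    by (intro sum.cong refl) (simp only: vec_lambda_beta complex_cnj_mult complex_cnj_cnj mult_ac)
qed

text \<open>
  Separation of \<open>M\<close> from \<open>C - pos_semidef\<close> in the real Euclidean space of all complex matrices. A
  separating functional is the inner product with a matrix \<open>a\<close>. On Hermitian matrices \<open>a\<close> may be
  replaced by its Hermitian part \<open>- A\<close>, and \<open>A\<close> is positive semidefinite because the functional is
  bounded below on \<open>C - pos_semidef\<close>.
\<close>

lemma pos_semidef_separation:
  fixes M :: "complex^'n^'n"
  assumes "compact C" "convex C" "C \<noteq> {}" "C \<subseteq> pos_semidef" "M \<in> pos_semidef"
    and le: "\<And>A. A \<in> pos_semidef \<Longrightarrow> \<exists>N\<in>C. inner A M \<le> inner A N"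
  shows "\<exists>N\<in>C. N - M \<in> pos_semidef"
proof (rule ccontr)
  assume neg: "\<not> ?thesis"
  define S where "S = (\<Union>x\<in>C. \<Union>y\<in>pos_semidef. {x - y})"
  have "closed S" unfolding S_def by (rule compact_closed_differences[OF assms(1) closed_pos_semidef])
  moreover have "convex S" unfolding S_def by (rule convex_differences[OF assms(2) convex_pos_semidef])
  moreover have "M \<notin> S"
  proof
    assume "M \<in> S"
    then obtain x y where "x \<in> C" "y \<in> pos_semidef" "M = x - y" unfolding S_def by blast
    thus False using neg by (metis add_diff_cancel_left' diff_diff_eq2 add.commute)
  qed
  ultimately have "\<exists>a b. inner a M < b \<and> (\<forall>x\<in>S. b < inner a x)"
    by (intro separating_hyperplane_closed_point)
  then obtain a b where ab: "inner a M < b" "\<And>x. x \<in> S \<Longrightarrow> b < inner a x" by blast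
  define A :: "complex^'n^'n" where "A = (\<chi> i j. - (a $ i $ j + cnj (a $ j $ i)) / 2)"
  have inner_A: "inner A X = - inner a X" if "X \<in> pos_semidef" for X
  proof -
    have herm: "X $ j $ i = cnj (X $ i $ j)" for i j using that unfolding pos_semidef_def by blast
    have "inner A X = (\<Sum>i\<in>UNIV. \<Sum>j\<in>UNIV. - inner (a $ i $ j) (X $ i $ j) / 2 - inner (a $ j $ i) (X $ j $ i) / 2)"
      unfolding inner_vec_def
    proof (intro sum.cong refl)
      fix i j
      have "inner (a $ j $ i) (X $ j $ i) = inner (cnj (a $ j $ i)) (X $ i $ j)"
        unfolding herm[of i j] by (simp add: inner_complex_def)
      thus "inner (A $ i $ j) (X $ i $ j) = - inner (a $ i $ j) (X $ i $ j) / 2 - inner (a $ j $ i) (X $ j $ i) / 2"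
        by (simp add: A_def inner_complex_def field_simps)
    qed
    also have "\<dots> = - inner a X / 2 - (\<Sum>i\<in>UNIV. \<Sum>j\<in>UNIV. inner (a $ j $ i) (X $ j $ i)) / 2"
      unfolding inner_vec_def by (simp add: sum_subtractf sum_negf flip: sum_divide_distrib)
    also have "(\<Sum>i\<in>UNIV. \<Sum>j\<in>UNIV. inner (a $ j $ i) (X $ j $ i)) = inner a X"
      unfolding inner_vec_def by (rule sum.swap)
    finally show ?thesis by simp
  qed
  obtain N0 where N0: "N0 \<in> C" using assms(3) by blast
  have "A \<in> pos_semidef"
    unfolding pos_semidef_iff psd_def
  proof (intro conjI ballI allI)
    show "A $ j $ i = cnj (A $ i $ j)" for i j by (simp add: A_def add.commute)
    fix x :: "'n \<Rightarrow> complex"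
    define P where "P = rank_one (\<chi> i. cnj (x i))"
    have P: "P \<in> pos_semidef" "inner A P = qform UNIV (\<lambda>i j. A $ i $ j) x"
      by (simp_all add: P_def rank_one_pos_semidef inner_rank_one)
    have bound: "- t * inner A P \<le> inner a N0 - b" if "0 \<le> t" for t
    proof -
      have "t *\<^sub>R P \<in> pos_semidef" using pos_semidef_lincomb[OF P(1) P(1) that, of 0] by simp
      hence "N0 - t *\<^sub>R P \<in> S" unfolding S_def using N0 by blast
      from ab(2)[OF this] show ?thesis
        using inner_A[OF P(1)] by (simp add: inner_diff_right)
    qed
    show "0 \<le> qform UNIV (\<lambda>i j. A $ i $ j) x"
    proof (rule ccontr)
      assume "\<not> ?thesis"
      hence neg: "inner A P < 0" using P(2) by simp
      have "0 \<le> inner a N0 - b" using bound[of 0] by simp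
      hence "- ((inner a N0 - b + 1) / - inner A P) * inner A P \<le> inner a N0 - b"
        using neg by (intro bound) (auto simp: divide_nonneg_neg)
      thus False using neg by simp
    qed
  qed
  then obtain N where N: "N \<in> C" "inner A M \<le> inner A N" using le by blast
  have "(0 :: complex^'n^'n) \<in> pos_semidef" using pos_semidef_lincomb[OF assms(5,5), of 0 0] by simp
  hence "N - 0 \<in> S" unfolding S_def using N(1) by blast
  hence "b < inner a N" using ab(2) by simp
  thus False
    using ab(1) N(2) inner_A[OF assms(5)] inner_A[OF subsetD[OF assms(4) N(1)]] by linarith
qed

lemma R_mats_eq: "R_mats = closure (convex hull (rank_one ` {u. \<forall>j. cmod (u $ j) = 1}))"
  unfolding R_mats_def rank_one_def by (rule arg_cong[where f="\<lambda>S. closure (convex hull S)"]) blast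

lemma rank_one_in_R_mats: "(\<And>j. cmod (u $ j) = 1) \<Longrightarrow> rank_one u \<in> R_mats"
  unfolding R_mats_eq by (intro subsetD[OF closure_subset] hull_inc) blast

lemma R_mats_subset_pos_semidef: "R_mats \<subseteq> pos_semidef"
  unfolding R_mats_eq
  by (intro closure_minimal hull_minimal closed_pos_semidef convex_pos_semidef)
    (auto intro: rank_one_pos_semidef)

lemma convex_R_mats: "convex R_mats"
  unfolding R_mats_def by (intro convex_closure convex_convex_hull)

lemma norm_le_sum_norm_components: "norm x \<le> (\<Sum>i\<in>UNIV. norm (x $ i))"
  unfolding norm_vec_def by (rule L2_set_le_sum) simp

lemma compact_R_mats: "compact (R_mats :: (complex^'n^'n) set)"
proof -
  have "norm (rank_one u) \<le> (\<Sum>i\<in>(UNIV :: 'n set). \<Sum>j\<in>(UNIV :: 'n set). 1)"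
    if "\<forall>j. cmod (u $ j) = 1" for u :: "complex^'n"
  proof -
    have "norm (rank_one u) \<le> (\<Sum>i\<in>UNIV. norm (rank_one u $ i))" by (rule norm_le_sum_norm_components)
    also have "\<dots> \<le> (\<Sum>i\<in>UNIV. \<Sum>j\<in>UNIV. norm (rank_one u $ i $ j))"
      by (intro sum_mono norm_le_sum_norm_components)
    also have "\<dots> = (\<Sum>i\<in>(UNIV :: 'n set). \<Sum>j\<in>(UNIV :: 'n set). 1)"
      using that by (simp add: rank_one_def norm_mult)
    finally show ?thesis .
  qed
  hence "bounded (rank_one ` {u :: complex^'n. \<forall>j. cmod (u $ j) = 1})"
    by (auto intro!: boundedI)
  thus ?thesis unfolding R_mats_eq by (simp add: compact_closure bounded_convex_hull)
qed

section \<open>The decomposition\<close>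

lemma qform_reindex:
  assumes "bij_betw f J I"
  shows "qform J (\<lambda>i j. A (f i) (f j)) (\<lambda>i. x (f i)) = qform I A x"
proof -
  have "(\<Sum>i\<in>J. \<Sum>j\<in>J. cnj (x (f i)) * A (f i) (f j) * x (f j))
      = (\<Sum>i\<in>J. \<Sum>j\<in>I. cnj (x (f i)) * A (f i) j * x j)"
    by (intro sum.cong refl sum.reindex_bij_betw[OF assms])
  also have "\<dots> = (\<Sum>i\<in>I. \<Sum>j\<in>I. cnj (x i) * A i j * x j)"
    by (rule sum.reindex_bij_betw[OF assms])
  finally show ?thesis unfolding qform_def by (rule arg_cong)
qed

text \<open>
  Factor \<open>A = X\<^sup>* X\<close>. The left side is at most the square of the completely bounded norm of \<open>X\<close>, and
  the square of \<open>F_norm X\<close> is at most \<open>g\<close>. The bijection \<open>f\<close> turns indices from a type into numbers.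
\<close>

lemma inner_Q_le:
  fixes A Q :: "complex^'n^'n"
  assumes A: "A \<in> pos_semidef" and Q: "Q \<in> Q_mats" and k: "k \<in> Grothendieck_bounds"
    and g: "\<And>u. (\<And>j. cmod (u $ j) = 1) \<Longrightarrow> inner A (rank_one u) \<le> g"
  shows "inner A Q \<le> k * g"
proof -
  define n where "n = CARD('n)"
  have n: "0 < n" by (simp add: n_def)
  obtain f :: "nat \<Rightarrow> 'n" where f: "bij_betw f {..<n} UNIV"
    using ex_bij_betw_nat_finite[of "UNIV :: 'n set"] unfolding n_def lessThan_atLeast0 by auto
  obtain v :: "'n \<Rightarrow> 'n \<Rightarrow> complex" where v: "\<And>i j. A $ i $ j = (\<Sum>k\<in>UNIV. cnj (v k i) * v k j)"
    by (rule psd_imp_gram[OF finite A[unfolded pos_semidef_iff]]) simp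
  define X where "X = Matrix.mat n n (\<lambda>(k, i). v (f k) (f i))"
  have X: "X \<in> carrier_mat n n" by (simp add: X_def)
  have "gram_entry X i j = A $ f i $ f j" if "i < n" "j < n" for i j
  proof -
    have "gram_entry X i j = (\<Sum>k<n. cnj (v (f k) (f i)) * v (f k) (f j))"
      using that by (simp add: gram_entry_def X_def)
    also have "\<dots> = A $ f i $ f j" unfolding v by (rule sum.reindex_bij_betw[OF f])
    finally show ?thesis .
  qed
  hence form: "qform {..<n} (gram_entry X) (\<lambda>i. y (f i)) = qform UNIV (\<lambda>i j. A $ i $ j) y" for y
    by (subst qform_reindex[OF f, symmetric]) (auto intro!: qform_cong)
  have F: "(F_norm X)\<^sup>2 \<le> g"
  proof (rule F_norm_power2_le[OF X])
    fix x :: "nat \<Rightarrow> complex" assume x: "\<And>j. j < n \<Longrightarrow> cmod (x j) \<le> 1"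
    define y where "y = (\<lambda>i. x (inv_into {..<n} f i))"
    have "inv_into {..<n} f i < n" for i
      using f by (metis UNIV_I bij_betw_imp_surj_on inv_into_into lessThan_iff)
    hence "cmod (y i) \<le> 1" for i using x by (simp add: y_def)
    then obtain u where u: "\<And>i. cmod (u i) = 1"
      "qform UNIV (\<lambda>i j. A $ i $ j) y \<le> qform UNIV (\<lambda>i j. A $ i $ j) u"
    proof (rule qform_le_torus[OF finite A[unfolded pos_semidef_iff], of y])
      fix u
      assume "\<And>i. i \<in> UNIV \<Longrightarrow> cmod (u i) = 1"
        "qform UNIV (\<lambda>i j. A $ i $ j) y \<le> qform UNIV (\<lambda>i j. A $ i $ j) u"
      thus thesis using that[of u] by blast
    qed
    have "qform {..<n} (gram_entry X) x = qform {..<n} (gram_entry X) (\<lambda>i. y (f i))"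
      using f by (intro qform_cong) (auto simp: y_def bij_betw_def)
    also have "\<dots> \<le> qform UNIV (\<lambda>i j. A $ i $ j) u" unfolding form by (rule u(2))
    also have "\<dots> = inner A (rank_one (\<chi> i. cnj (u i)))" by (simp add: inner_rank_one)
    also have "\<dots> \<le> g" using u(1) by (intro g) simp
    finally show "qform {..<n} (gram_entry X) x \<le> g" .
  qed
  have Qpsd: "Q \<in> pos_semidef" and Qdiag: "\<And>i. Q $ i $ i = 1" using Q by (auto simp: Q_mats_def)
  obtain w :: "'n \<Rightarrow> 'n \<Rightarrow> complex" where w: "\<And>i j. Q $ i $ j = (\<Sum>k\<in>UNIV. cnj (w k i) * w k j)"
    by (rule psd_imp_gram[OF finite Qpsd[unfolded pos_semidef_iff]]) simp
  have w1: "(\<Sum>k\<in>UNIV. (cmod (w k i))\<^sup>2) = 1" for i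
  proof -
    have "complex_of_real (\<Sum>k\<in>UNIV. (cmod (w k i))\<^sup>2) = Q $ i $ i"
      unfolding w by (rule gram_diag[symmetric])
    thus ?thesis unfolding Qdiag by (simp only: of_real_eq_1_iff)
  qed
  have "Q = (\<Sum>k\<in>UNIV. rank_one (\<chi> i. w k i))"
    by (simp add: Finite_Cartesian_Product.vec_eq_iff w rank_one_def)
  hence "inner A Q = (\<Sum>k\<in>UNIV. qform UNIV (\<lambda>i j. A $ i $ j) (\<lambda>i. cnj (w k i)))"
    by (simp add: inner_sum_right inner_rank_one)
  also have "\<dots> = (\<Sum>k\<in>UNIV. qform {..<n} (gram_entry X) (\<lambda>i. cnj (w k (f i))))"
    by (simp only: form[symmetric])
  also have "\<dots> \<le> (cbF_norm X)\<^sup>2"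
    by (rule sum_qform_le_cbF_norm[OF X n]) (simp add: w1)
  also have "\<dots> \<le> (sqrt k * F_norm X)\<^sup>2"
    using k n X by (intro power_mono cbF_norm_nonneg[OF X n]) (auto simp: Grothendieck_bounds_def)
  also have "\<dots> \<le> k * g"
    using k F by (auto simp: Grothendieck_bounds_def power_mult_distrib intro!: mult_left_mono)
  finally show ?thesis .
qed

theorem proposition5p3:
  fixes Q :: "complex^'n^'n"
  assumes "Q \<in> Q_mats"
  shows "\<exists>R P. R \<in> R_mats \<and> P \<in> pos_semidef \<and> Q = little_Grothendieck_const *\<^sub>R R - P"
proof -
  let ?K = little_Grothendieck_const
  let ?C = "(\<lambda>R :: complex^'n^'n. ?K *\<^sub>R R) ` R_mats"
  define I :: "complex^'n^'n" where "I = rank_one (\<chi> i. 1)"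
  have I: "I \<in> R_mats" unfolding I_def by (rule rank_one_in_R_mats) simp
  have "\<exists>N\<in>?C. N - Q \<in> pos_semidef"
  proof (rule pos_semidef_separation)
    show "compact ?C" by (rule compact_scaling[OF compact_R_mats])
    show "convex ?C" by (rule convex_scaling[OF convex_R_mats])
    show "?C \<noteq> {}" using I by blast
    show "?C \<subseteq> pos_semidef"
    proof
      fix N assume "N \<in> ?C"
      then obtain R where "R \<in> R_mats" "N = ?K *\<^sub>R R" by blast
      thus "N \<in> pos_semidef"
        using pos_semidef_lincomb[of R R ?K 0] R_mats_subset_pos_semidef
          little_Grothendieck_const_nonneg by auto
    qed
    show "Q \<in> pos_semidef" using assms by (simp add: Q_mats_def)
    fix A :: "complex^'n^'n" assume A: "A \<in> pos_semidef"
    have "continuous_on R_mats (inner A)" by (intro continuous_intros)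
    then obtain R where R: "R \<in> R_mats" "\<And>N. N \<in> R_mats \<Longrightarrow> inner A N \<le> inner A R"
      using continuous_attains_sup[OF compact_R_mats] I by blast
    have "0 \<le> inner A I"
      unfolding I_def inner_rank_one using A by (intro psd_qform_nonneg) (simp only: pos_semidef_iff)
    hence "0 \<le> inner A R" using R(2)[OF I] by linarith
    moreover have "inner A Q \<le> k * inner A R" if "k \<in> Grothendieck_bounds" for k
      by (rule inner_Q_le[OF A assms that]) (intro R(2) rank_one_in_R_mats)
    ultimately have "inner A Q \<le> ?K * inner A R" by (rule le_little_Grothendieck_const_mult)
    thus "\<exists>N\<in>?C. inner A Q \<le> inner A N" using R(1) by (intro bexI[of _ "?K *\<^sub>R R"]) auto
  qed
  then obtain R where "R \<in> R_mats" "?K *\<^sub>R R - Q \<in> pos_semidef" by blast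
  moreover have "Q = ?K *\<^sub>R R - (?K *\<^sub>R R - Q)" by simp
  ultimately show ?thesis by blast
qed

end
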